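(* Let $K$ be an algebraically closed field of characteristic zero, let $\mathfrak{g}$ be a finite dimensional nonabelian Lie algebra over $K$, and let $U = U(\mathfrak{g})$ be its universal enveloping algebra. Let $U_1 = \mathfrak{g} \oplus K \subseteq U$. Then there is a nonempty (Zariski) open subset $X$ of $U_1$ such that the left $U$-module $U/Ux$ is faithful for all $x \in X$.
   Context: $U_1 = \mathfrak{g}\oplus K$ is the finite dimensional subspace of $U$ spanned by $\mathfrak{g}$ and the scalars; it is given the Zariski topology. A left $U$-module $M$ is faithful if its annihilator $\{u \in U : uM = 0\}$ is zero. *)

theory Defs
  imports
    "HOL-Algebra.Algebra"
    "HOL-Algebra.Algebraic_Closure_Type"
    "HOL-Library.Poly_Mapping"
    "HOL-Analysis.Abstract_Topology"
begin

section \<open>Lie algebras\<close>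

locale lie_algebra = Vector_Spaces.vector_space scale
  for scale :: "'k::field \<Rightarrow> 'g::ab_group_add \<Rightarrow> 'g" +
  fixes bracket :: "'g \<Rightarrow> 'g \<Rightarrow> 'g"
  assumes bracket_linear_left: "Vector_Spaces.linear scale scale (\<lambda>x. bracket x y)"
    and bracket_linear_right: "Vector_Spaces.linear scale scale (\<lambda>y. bracket x y)"
    and bracket_self: "bracket x x = 0"
    and jacobi: "bracket x (bracket y z) + bracket y (bracket z x) + bracket z (bracket x y) = 0"

definition abelian_bracket :: "('g::zero \<Rightarrow> 'g \<Rightarrow> 'g) \<Rightarrow> bool" where
  "abelian_bracket bracket \<longleftrightarrow> (\<forall>x y. bracket x y = 0)"


section \<open>The free associative algebra on a type\<close>

(* Words under concatenation, written additively, because the product of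
   poly_mapping is the convolution product over an additive monoid of exponents.
   With this instance the type "'a free_word \<Rightarrow>\<^sub>0 'k" is the free associative unital
   algebra over 'k on 'a. *)

datatype 'a free_word = Free_Word (letters: "'a list")

instantiation free_word :: (type) monoid_add
begin

definition zero_free_word :: "'a free_word" where
  "zero_free_word = Free_Word []"

definition plus_free_word :: "'a free_word \<Rightarrow> 'a free_word \<Rightarrow> 'a free_word" where
  "plus_free_word u v = Free_Word (letters u @ letters v)"

instance
  by standard (auto simp: zero_free_word_def plus_free_word_def)

end

type_synonym ('k, 'g) free_alg = "'g free_word \<Rightarrow>\<^sub>0 'k"

definition free_scalar :: "'k::ring_1 \<Rightarrow> ('k, 'g) free_alg" where
  "free_scalar c = Poly_Mapping.single 0 c"

definition free_gen :: "'g \<Rightarrow> ('k::ring_1, 'g) free_alg" where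
  "free_gen x = Poly_Mapping.single (Free_Word [x]) 1"


section \<open>The universal enveloping algebra\<close>

(* The first two families of relations make the generators depend linearly on the
   elements of the Lie algebra, so that the free algebra on the underlying set becomes
   the tensor algebra; the third family gives the enveloping algebra as a quotient
   of the tensor algebra. *)

definition enveloping_relations ::
    "('k::field \<Rightarrow> 'g::ab_group_add \<Rightarrow> 'g) \<Rightarrow> ('g \<Rightarrow> 'g \<Rightarrow> 'g) \<Rightarrow> ('k, 'g) free_alg set" where
  "enveloping_relations scale bracket =
     {free_gen (x + y) - free_gen x - free_gen y | x y. True}
   \<union> {free_gen (scale c x) - free_scalar c * free_gen x | c x. True}
   \<union> {free_gen x * free_gen y - free_gen y * free_gen x - free_gen (bracket x y) | x y. True}"

abbreviation free_ring :: "('k::field, 'g) free_alg ring" where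
  "free_ring \<equiv> ring_of_type_algebra"

definition enveloping_ideal ::
    "('k::field \<Rightarrow> 'g::ab_group_add \<Rightarrow> 'g) \<Rightarrow> ('g \<Rightarrow> 'g \<Rightarrow> 'g) \<Rightarrow> ('k, 'g) free_alg set" where
  "enveloping_ideal scale bracket = Idl\<^bsub>free_ring\<^esub> (enveloping_relations scale bracket)"

(* A 'k-algebra is represented by a record of type module: the ring together with the
   scalar multiplication. (The locale algebra of HOL-Algebra is for commutative
   rings only, so only the record is used.) *)

definition enveloping_algebra ::
    "('k::field \<Rightarrow> 'g::ab_group_add \<Rightarrow> 'g) \<Rightarrow> ('g \<Rightarrow> 'g \<Rightarrow> 'g)
       \<Rightarrow> ('k, ('k, 'g) free_alg set) module" where
  "enveloping_algebra scale bracket =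
     (let I = enveloping_ideal scale bracket; Q = free_ring Quot I in
       \<lparr>carrier = carrier Q, monoid.mult = monoid.mult Q, monoid.one = monoid.one Q, ring.zero = ring.zero Q,
        ring.add = ring.add Q, module.smult = (\<lambda>c u. (I +>\<^bsub>free_ring\<^esub> free_scalar c) \<otimes>\<^bsub>Q\<^esub> u)\<rparr>)"

definition enveloping_gen ::
    "('k::field \<Rightarrow> 'g::ab_group_add \<Rightarrow> 'g) \<Rightarrow> ('g \<Rightarrow> 'g \<Rightarrow> 'g) \<Rightarrow> 'g \<Rightarrow> ('k, 'g) free_alg set" where
  "enveloping_gen scale bracket x =
     enveloping_ideal scale bracket +>\<^bsub>free_ring\<^esub> free_gen x"

lemma ring_free_ring: "ring (ring_of_type_algebra :: 'a::ring_1 ring)"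
proof -
  have "\<exists>y. x + y = 0" for x :: 'a
    using add.right_inverse by blast
  then show ?thesis
    unfolding ring_of_type_algebra_def using add.right_inverse
    by unfold_locales (auto simp: algebra_simps Units_def)
qed

lemma enveloping_ideal_ideal: "ideal (enveloping_ideal scale bracket) free_ring"
  unfolding enveloping_ideal_def
  by (intro ring.genideal_ideal ring_free_ring) (simp add: ring_of_type_algebra_def)

lemma enveloping_algebra_ring: "ring (enveloping_algebra scale bracket)"
proof -
  interpret ideal "enveloping_ideal scale bracket" free_ring by (rule enveloping_ideal_ideal)
  interpret Q: ring "free_ring Quot enveloping_ideal scale bracket" by (rule quotient_is_ring)
  show ?thesis
    apply (rule ringI)
       apply (rule abelian_groupI)
    using Q.a_closed Q.add.m_assoc Q.add.m_comm Q.add.l_inv_ex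
             apply (simp_all add: enveloping_algebra_def Let_def Q.l_distr Q.r_distr)
    apply (rule monoidI)
        apply (auto simp: Q.m_assoc)
    done
qed

lemma enveloping_algebra_module:
  fixes scale :: "'k::field \<Rightarrow> 'g::ab_group_add \<Rightarrow> 'g"
  shows "Module.module (ring_of_type_algebra :: 'k ring) (enveloping_algebra scale bracket)"
proof -
  define I where "I = enveloping_ideal scale bracket"
  interpret ideal I "free_ring :: ('k,'g) free_alg ring" unfolding I_def by (rule enveloping_ideal_ideal)
  interpret Q: ring "free_ring Quot I" by (rule quotient_is_ring)
  note h = rcos_ring_hom
  let ?s = "\<lambda>c. I +>\<^bsub>free_ring\<^esub> free_scalar c"
  have s[simp]: "?s c \<in> carrier (free_ring Quot I)" for c
    using ring_hom_closed[OF h, of "free_scalar c"] by (simp add: ring_of_type_algebra_def)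
  have s_add: "?s (a + b) = ?s a \<oplus>\<^bsub>free_ring Quot I\<^esub> ?s b" for a b
    using ring_hom_add[OF h, of "free_scalar a" "free_scalar b"] by (simp add: ring_of_type_algebra_def free_scalar_def single_add)
  have s_mult: "?s (a * b) = ?s a \<otimes>\<^bsub>free_ring Quot I\<^esub> ?s b" for a b
    using ring_hom_mult[OF h, of "free_scalar a" "free_scalar b"] by (simp add: ring_of_type_algebra_def free_scalar_def mult_single)
  have s_one: "?s 1 = \<one>\<^bsub>free_ring Quot I\<^esub>"
    using ring_hom_one[OF h] by (simp add: ring_of_type_algebra_def free_scalar_def)
  have sel: "carrier (enveloping_algebra scale bracket) = carrier (free_ring Quot I)"
    "\<And>x y. x \<oplus>\<^bsub>enveloping_algebra scale bracket\<^esub> y = x \<oplus>\<^bsub>free_ring Quot I\<^esub> y"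
    "\<And>c y. c \<odot>\<^bsub>enveloping_algebra scale bracket\<^esub> y = ?s c \<otimes>\<^bsub>free_ring Quot I\<^esub> y"
    by (simp_all add: enveloping_algebra_def Let_def I_def)
  have k: "\<And>a b::'k. a \<oplus>\<^bsub>ring_of_type_algebra\<^esub> b = a + b" "\<And>a b::'k. a \<otimes>\<^bsub>ring_of_type_algebra\<^esub> b = a * b"
    "\<one>\<^bsub>ring_of_type_algebra :: 'k ring\<^esub> = 1"
    by (simp_all add: ring_of_type_algebra_def)
  show ?thesis
  proof (rule moduleI)
    show "cring (ring_of_type_algebra :: 'k ring)" by (rule comm_ring_1_class.cring_from_type_algebra)
    show "abelian_group (enveloping_algebra scale bracket)" by (intro ring.is_abelian_group enveloping_algebra_ring)
  qed (simp_all only: sel k s_add s_mult s_one s Q.l_distr Q.r_distr Q.m_assoc Q.m_closed Q.l_one)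
qed

lemma enveloping_coset_eqI:
  assumes "a - b \<in> enveloping_relations scale bracket"
  shows "enveloping_ideal scale bracket +>\<^bsub>free_ring\<^esub> a = enveloping_ideal scale bracket +>\<^bsub>free_ring\<^esub> b"
proof -
  interpret ideal "enveloping_ideal scale bracket" free_ring by (rule enveloping_ideal_ideal)
  have "a - b \<in> enveloping_ideal scale bracket"
    using assms unfolding enveloping_ideal_def genideal_def by blast
  then have "a \<in> enveloping_ideal scale bracket +>\<^bsub>free_ring\<^esub> b"
    by (auto simp: a_r_coset_def' ring_of_type_algebra_def intro!: bexI[of _ "a - b"])
  then show ?thesis
    using a_repr_independence'[of a b] by (simp add: ring_of_type_algebra_def)
qed

lemma enveloping_algebra_sel:
  fixes scale :: "'k::field \<Rightarrow> 'g::ab_group_add \<Rightarrow> 'g"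
  defines "I \<equiv> enveloping_ideal scale"
  shows
  "(I bracket +>\<^bsub>free_ring\<^esub> a) \<oplus>\<^bsub>enveloping_algebra scale bracket\<^esub> (I bracket +>\<^bsub>free_ring\<^esub> b) = I bracket +>\<^bsub>free_ring\<^esub> (a + b)"
  "(I bracket +>\<^bsub>free_ring\<^esub> a) \<otimes>\<^bsub>enveloping_algebra scale bracket\<^esub> (I bracket +>\<^bsub>free_ring\<^esub> b) = I bracket +>\<^bsub>free_ring\<^esub> (a * b)"
  "c \<odot>\<^bsub>enveloping_algebra scale bracket\<^esub> (I bracket +>\<^bsub>free_ring\<^esub> b) = I bracket +>\<^bsub>free_ring\<^esub> (free_scalar c * b)"
  "\<one>\<^bsub>enveloping_algebra scale bracket\<^esub> = I bracket +>\<^bsub>free_ring\<^esub> 1"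
proof -
  interpret ideal "I bracket" "free_ring :: ('k,'g) free_alg ring" unfolding I_def by (rule enveloping_ideal_ideal)
  note h = rcos_ring_hom
  show "(I bracket +>\<^bsub>free_ring\<^esub> a) \<oplus>\<^bsub>enveloping_algebra scale bracket\<^esub> (I bracket +>\<^bsub>free_ring\<^esub> b) = I bracket +>\<^bsub>free_ring\<^esub> (a + b)"
    using ring_hom_add[OF h, of a b] by (simp add: enveloping_algebra_def Let_def I_def ring_of_type_algebra_def)
  show "(I bracket +>\<^bsub>free_ring\<^esub> a) \<otimes>\<^bsub>enveloping_algebra scale bracket\<^esub> (I bracket +>\<^bsub>free_ring\<^esub> b) = I bracket +>\<^bsub>free_ring\<^esub> (a * b)"
    using ring_hom_mult[OF h, of a b] by (simp add: enveloping_algebra_def Let_def I_def ring_of_type_algebra_def)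
  show "c \<odot>\<^bsub>enveloping_algebra scale bracket\<^esub> (I bracket +>\<^bsub>free_ring\<^esub> b) = I bracket +>\<^bsub>free_ring\<^esub> (free_scalar c * b)"
    using ring_hom_mult[OF h, of "free_scalar c" b] by (simp add: enveloping_algebra_def Let_def I_def ring_of_type_algebra_def)
  show "\<one>\<^bsub>enveloping_algebra scale bracket\<^esub> = I bracket +>\<^bsub>free_ring\<^esub> 1"
    using ring_hom_one[OF h] by (simp add: enveloping_algebra_def Let_def I_def ring_of_type_algebra_def)
qed

lemma enveloping_gen_relations:
  fixes scale :: "'k::field \<Rightarrow> 'g::ab_group_add \<Rightarrow> 'g" and bracket
  defines "U \<equiv> enveloping_algebra scale bracket" and "\<iota> \<equiv> enveloping_gen scale bracket"
  shows "\<iota> (x + y) = \<iota> x \<oplus>\<^bsub>U\<^esub> \<iota> y"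
    and "\<iota> (scale c x) = c \<odot>\<^bsub>U\<^esub> \<iota> x"
    and "\<iota> x \<otimes>\<^bsub>U\<^esub> \<iota> y = \<iota> y \<otimes>\<^bsub>U\<^esub> \<iota> x \<oplus>\<^bsub>U\<^esub> \<iota> (bracket x y)"
proof -
  show "\<iota> (x + y) = \<iota> x \<oplus>\<^bsub>U\<^esub> \<iota> y"
    unfolding assms enveloping_gen_def enveloping_algebra_sel
    by (rule enveloping_coset_eqI) (auto simp: enveloping_relations_def diff_diff_eq)
  show "\<iota> (scale c x) = c \<odot>\<^bsub>U\<^esub> \<iota> x"
    unfolding assms enveloping_gen_def enveloping_algebra_sel
    by (rule enveloping_coset_eqI) (auto simp: enveloping_relations_def diff_diff_eq)
  show "\<iota> x \<otimes>\<^bsub>U\<^esub> \<iota> y = \<iota> y \<otimes>\<^bsub>U\<^esub> \<iota> x \<oplus>\<^bsub>U\<^esub> \<iota> (bracket x y)"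
    unfolding assms enveloping_gen_def enveloping_algebra_sel
    by (rule enveloping_coset_eqI) (auto simp: enveloping_relations_def diff_diff_eq)
qed

(* The vector space g + K inside U(g), with the operations of U(g). *)

definition enveloping_U1 ::
    "('k::field \<Rightarrow> 'g::ab_group_add \<Rightarrow> 'g) \<Rightarrow> ('g \<Rightarrow> 'g \<Rightarrow> 'g)
       \<Rightarrow> ('k, ('k, 'g) free_alg set) module" where
  "enveloping_U1 scale bracket =
     (let U = enveloping_algebra scale bracket in
       U\<lparr>carrier :=
         {enveloping_gen scale bracket x \<oplus>\<^bsub>U\<^esub> (c \<odot>\<^bsub>U\<^esub> \<one>\<^bsub>U\<^esub>) | x c. True}\<rparr>)"


section \<open>The Zariski topology on a vector space\<close>

definition linear_functional :: "('k::field, 'v, 'm) module_scheme \<Rightarrow> ('v \<Rightarrow> 'k) \<Rightarrow> bool" where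
  "linear_functional V f \<longleftrightarrow>
     (\<forall>u\<in>carrier V. \<forall>v\<in>carrier V. f (u \<oplus>\<^bsub>V\<^esub> v) = f u + f v) \<and>
     (\<forall>c. \<forall>v\<in>carrier V. f (c \<odot>\<^bsub>V\<^esub> v) = c * f v)"

(* The algebra of functions generated by the linear functionals, i.e. the polynomials
   in the coordinates with respect to any basis when V is finite dimensional.
   Values outside the carrier are irrelevant. *)

inductive polynomial_function :: "('k::field, 'v, 'm) module_scheme \<Rightarrow> ('v \<Rightarrow> 'k) \<Rightarrow> bool"
  for V where
  const: "polynomial_function V (\<lambda>_. c)"
| linear: "linear_functional V f \<Longrightarrow> polynomial_function V f"
| add: "polynomial_function V f \<Longrightarrow> polynomial_function V g \<Longrightarrow> polynomial_function V (\<lambda>v. f v + g v)"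
| mult: "polynomial_function V f \<Longrightarrow> polynomial_function V g \<Longrightarrow> polynomial_function V (\<lambda>v. f v * g v)"

definition zero_locus :: "('k::field, 'v, 'm) module_scheme \<Rightarrow> ('v \<Rightarrow> 'k) set \<Rightarrow> 'v set" where
  "zero_locus V P = {v \<in> carrier V. \<forall>p\<in>P. p v = 0}"

definition zariski_open :: "('k::field, 'v, 'm) module_scheme \<Rightarrow> 'v set \<Rightarrow> bool" where
  "zariski_open V S \<longleftrightarrow>
     S \<subseteq> carrier V \<and> (\<exists>P. (\<forall>p\<in>P. polynomial_function V p) \<and> carrier V - S = zero_locus V P)"

definition zariski_topology :: "('k::field, 'v, 'm) module_scheme \<Rightarrow> 'v topology" where
  "zariski_topology V = topology (zariski_open V)"

lemma istopology_zariski_open: "istopology (zariski_open V)"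
  unfolding istopology_def
proof (intro conjI allI impI)
  fix S Y
  assume "zariski_open V S" "zariski_open V Y"
  then obtain P Q where
    P: "S \<subseteq> carrier V" "\<forall>p\<in>P. polynomial_function V p" "carrier V - S = zero_locus V P" and
    Q: "Y \<subseteq> carrier V" "\<forall>p\<in>Q. polynomial_function V p" "carrier V - Y = zero_locus V Q"
    unfolding zariski_open_def by blast
  define R where "R = {\<lambda>v. p v * q v | p q. p \<in> P \<and> q \<in> Q}"
  have "\<forall>p\<in>R. polynomial_function V p"
    using P(2) Q(2) by (auto simp: R_def intro: polynomial_function.mult)
  moreover have "zero_locus V R = zero_locus V P \<union> zero_locus V Q"
    unfolding R_def zero_locus_def by fastforce
  then have "carrier V - S \<inter> Y = zero_locus V R"
    using P(3) Q(3) by blast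
  ultimately show "zariski_open V (S \<inter> Y)"
    using P(1) unfolding zariski_open_def by blast
next
  fix F
  assume "\<forall>S\<in>F. zariski_open V S"
  then obtain P where
    P: "\<And>S. S \<in> F \<Longrightarrow> S \<subseteq> carrier V \<and> (\<forall>p\<in>P S. polynomial_function V p) \<and>
          carrier V - S = zero_locus V (P S)"
    unfolding zariski_open_def by metis
  have "carrier V - \<Union>F = zero_locus V (\<Union>S\<in>F. P S)"
  proof -
    have "v \<notin> S \<longleftrightarrow> (\<forall>p\<in>P S. p v = 0)" if "S \<in> F" "v \<in> carrier V" for S v
      using P[OF that(1)] that(2) unfolding zero_locus_def by blast
    then show ?thesis
      unfolding zero_locus_def by auto
  qed
  then show "zariski_open V (\<Union>F)"
    unfolding zariski_open_def using P
    by (intro conjI exI[of _ "\<Union>S\<in>F. P S"]) blast+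
qed

lemma openin_zariski_topology [simp]: "openin (zariski_topology V) S = zariski_open V S"
  unfolding zariski_topology_def by (simp add: istopology_zariski_open topology_inverse')

lemma topspace_zariski_topology [simp]: "topspace (zariski_topology V) = carrier V"
proof -
  have "zero_locus V {\<lambda>_. 1} = {}"
    by (auto simp: zero_locus_def)
  then have "zariski_open V (carrier V)"
    unfolding zariski_open_def
    by (intro conjI exI[of _ "{\<lambda>_. 1}"]) (auto intro: polynomial_function.const)
  moreover have "S \<subseteq> carrier V" if "zariski_open V S" for S
    using that by (simp add: zariski_open_def)
  ultimately show ?thesis
    unfolding topspace_def openin_zariski_topology by blast
qed


section \<open>Left modules over noncommutative rings\<close>

(* The locale module of HOL-Algebra requires a commutative ring. As there, the
   fields mult and one of the record M play no role. *)

locale left_module = R?: ring R + M?: abelian_group M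
  for R :: "('r, 'n) ring_scheme" (structure) and M :: "('r, 'v, 'm) module_scheme" (structure) +
  assumes smult_closed:
      "\<lbrakk>a \<in> carrier R; x \<in> carrier M\<rbrakk> \<Longrightarrow> a \<odot>\<^bsub>M\<^esub> x \<in> carrier M"
    and smult_l_distr: "\<lbrakk>a \<in> carrier R; b \<in> carrier R; x \<in> carrier M\<rbrakk> \<Longrightarrow>
      (a \<oplus>\<^bsub>R\<^esub> b) \<odot>\<^bsub>M\<^esub> x = a \<odot>\<^bsub>M\<^esub> x \<oplus>\<^bsub>M\<^esub> b \<odot>\<^bsub>M\<^esub> x"
    and smult_r_distr: "\<lbrakk>a \<in> carrier R; x \<in> carrier M; y \<in> carrier M\<rbrakk> \<Longrightarrow>
      a \<odot>\<^bsub>M\<^esub> (x \<oplus>\<^bsub>M\<^esub> y) = a \<odot>\<^bsub>M\<^esub> x \<oplus>\<^bsub>M\<^esub> a \<odot>\<^bsub>M\<^esub> y"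
    and smult_assoc: "\<lbrakk>a \<in> carrier R; b \<in> carrier R; x \<in> carrier M\<rbrakk> \<Longrightarrow>
      (a \<otimes>\<^bsub>R\<^esub> b) \<odot>\<^bsub>M\<^esub> x = a \<odot>\<^bsub>M\<^esub> (b \<odot>\<^bsub>M\<^esub> x)"
    and smult_one: "x \<in> carrier M \<Longrightarrow> \<one>\<^bsub>R\<^esub> \<odot>\<^bsub>M\<^esub> x = x"

definition annihilator :: "('r, 'n) ring_scheme \<Rightarrow> ('r, 'v, 'm) module_scheme \<Rightarrow> 'r set" where
  "annihilator R M = {r \<in> carrier R. \<forall>m\<in>carrier M. r \<odot>\<^bsub>M\<^esub> m = \<zero>\<^bsub>M\<^esub>}"

definition faithful_module :: "('r, 'n) ring_scheme \<Rightarrow> ('r, 'v, 'm) module_scheme \<Rightarrow> bool" where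
  "faithful_module R M \<longleftrightarrow> left_module R M \<and> annihilator R M = {\<zero>\<^bsub>R\<^esub>}"

(* The left R-module R/L for a left ideal L; the action is r (L + c) = L + r c. *)

definition left_quotient :: "('r, 'n) ring_scheme \<Rightarrow> 'r set \<Rightarrow> ('r, 'r set) module" where
  "left_quotient R L =
     \<lparr>carrier = a_rcosets\<^bsub>R\<^esub> L, monoid.mult = undefined, monoid.one = undefined, ring.zero = L,
      ring.add = set_add R, module.smult = (\<lambda>r C. \<Union>c\<in>C. L +>\<^bsub>R\<^esub> (r \<otimes>\<^bsub>R\<^esub> c))\<rparr>"

(* PIdl_R a is the set of all r a with r in R, so it is the left ideal R a
   also for noncommutative R. *)

abbreviation cyclic_quotient :: "('r, 'n) ring_scheme \<Rightarrow> 'r \<Rightarrow> ('r, 'r set) module" where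
  "cyclic_quotient R a \<equiv> left_quotient R (PIdl\<^bsub>R\<^esub> a)"

lemma left_module_left_quotient:
  assumes "ring R" and L: "additive_subgroup L R" and c: "\<And>r l. r \<in> carrier R \<Longrightarrow> l \<in> L \<Longrightarrow> r \<otimes>\<^bsub>R\<^esub> l \<in> L"
  shows "left_module R (left_quotient R L)"
proof -
  interpret R: ring R by fact
  interpret additive_subgroup L R by fact
  interpret abelian_subgroup L R by (rule abelian_subgroupI3) (unfold_locales)
  have car: "carrier (left_quotient R L) = {L +>\<^bsub>R\<^esub> x |x. x \<in> carrier R}"
    by (auto simp: left_quotient_def A_RCOSETS_def')
  have add: "(L +>\<^bsub>R\<^esub> x) \<oplus>\<^bsub>left_quotient R L\<^esub> (L +>\<^bsub>R\<^esub> y) = L +>\<^bsub>R\<^esub> (x \<oplus>\<^bsub>R\<^esub> y)"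
    if "x \<in> carrier R" "y \<in> carrier R" for x y
    using that by (simp add: left_quotient_def a_rcos_sum)
  have abg: "abelian_group (left_quotient R L)"
  proof (rule abelian_groupI)
    have z: "\<zero>\<^bsub>left_quotient R L\<^esub> = L +>\<^bsub>R\<^esub> \<zero>\<^bsub>R\<^esub>"
      using a_subset by (simp add: left_quotient_def)
    show "\<zero>\<^bsub>left_quotient R L\<^esub> \<in> carrier (left_quotient R L)"
      unfolding z car by blast
    show "\<zero>\<^bsub>left_quotient R L\<^esub> \<oplus>\<^bsub>left_quotient R L\<^esub> x = x" if "x \<in> carrier (left_quotient R L)" for x
      using that unfolding z car by (auto simp only: add R.zero_closed R.l_zero)
    show "\<exists>y\<in>carrier (left_quotient R L). y \<oplus>\<^bsub>left_quotient R L\<^esub> x = \<zero>\<^bsub>left_quotient R L\<^esub>"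
      if "x \<in> carrier (left_quotient R L)" for x
    proof -
      from that obtain a where a: "x = L +>\<^bsub>R\<^esub> a" "a \<in> carrier R" unfolding car by blast
      then show ?thesis
        unfolding z car by (intro bexI[of _ "L +>\<^bsub>R\<^esub> (\<ominus>\<^bsub>R\<^esub> a)"]) (auto simp only: add R.l_neg R.a_inv_closed)
    qed
  next
    fix x y z
    assume "x \<in> carrier (left_quotient R L)" "y \<in> carrier (left_quotient R L)"
      "z \<in> carrier (left_quotient R L)"
    then obtain a b c where abc: "x = L +>\<^bsub>R\<^esub> a" "y = L +>\<^bsub>R\<^esub> b" "z = L +>\<^bsub>R\<^esub> c"
      "a \<in> carrier R" "b \<in> carrier R" "c \<in> carrier R"
      unfolding car by blast
    show "x \<oplus>\<^bsub>left_quotient R L\<^esub> y \<in> carrier (left_quotient R L)"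
      unfolding abc add[OF abc(4,5)] car using R.a_closed[OF abc(4,5)] by blast
    show "x \<oplus>\<^bsub>left_quotient R L\<^esub> y = y \<oplus>\<^bsub>left_quotient R L\<^esub> x"
      using abc(4-6) by (simp add: abc(1-3) add R.a_comm)
    show "x \<oplus>\<^bsub>left_quotient R L\<^esub> y \<oplus>\<^bsub>left_quotient R L\<^esub> z =
        x \<oplus>\<^bsub>left_quotient R L\<^esub> (y \<oplus>\<^bsub>left_quotient R L\<^esub> z)"
      using abc(4-6) by (simp add: abc(1-3) add R.a_assoc)
  qed
  have sm: "r \<odot>\<^bsub>left_quotient R L\<^esub> (L +>\<^bsub>R\<^esub> x) = L +>\<^bsub>R\<^esub> (r \<otimes>\<^bsub>R\<^esub> x)"
    if "x \<in> carrier R" "r \<in> carrier R" for x r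
  proof -
    have "L +>\<^bsub>R\<^esub> (r \<otimes>\<^bsub>R\<^esub> y) = L +>\<^bsub>R\<^esub> (r \<otimes>\<^bsub>R\<^esub> x)" if y: "y \<in> L +>\<^bsub>R\<^esub> x" for y
    proof -
      obtain l where l: "l \<in> L" "y = l \<oplus>\<^bsub>R\<^esub> x" using y by (auto simp: a_r_coset_def')
      have "r \<otimes>\<^bsub>R\<^esub> y = (r \<otimes>\<^bsub>R\<^esub> l) \<oplus>\<^bsub>R\<^esub> (r \<otimes>\<^bsub>R\<^esub> x)"
        using l \<open>x \<in> carrier R\<close> \<open>r \<in> carrier R\<close> a_subset by (auto simp: R.r_distr)
      then have "r \<otimes>\<^bsub>R\<^esub> y \<in> L +>\<^bsub>R\<^esub> (r \<otimes>\<^bsub>R\<^esub> x)"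
        using c[OF \<open>r \<in> carrier R\<close> l(1)] by (auto simp: a_r_coset_def')
      then show ?thesis
        using a_repr_independence'[of "r \<otimes>\<^bsub>R\<^esub> y" "r \<otimes>\<^bsub>R\<^esub> x"] \<open>x \<in> carrier R\<close> \<open>r \<in> carrier R\<close> by simp
    qed
    moreover have "x \<in> L +>\<^bsub>R\<^esub> x" using that a_rcos_self by blast
    ultimately have "(\<Union>y\<in>L +>\<^bsub>R\<^esub> x. L +>\<^bsub>R\<^esub> (r \<otimes>\<^bsub>R\<^esub> y)) = L +>\<^bsub>R\<^esub> (r \<otimes>\<^bsub>R\<^esub> x)"
      by blast
    then show ?thesis by (simp add: left_quotient_def)
  qed
  show ?thesis
  proof (intro left_module.intro left_module_axioms.intro \<open>ring R\<close> abg)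
    fix r x y
    assume r: "r \<in> carrier R"
    assume "x \<in> carrier (left_quotient R L)"
    then obtain a where a: "x = L +>\<^bsub>R\<^esub> a" "a \<in> carrier R" unfolding car by blast
    show "r \<odot>\<^bsub>left_quotient R L\<^esub> x \<in> carrier (left_quotient R L)"
      unfolding a(1) sm[OF a(2) r] car using R.m_closed[OF r a(2)] by blast
    assume "y \<in> carrier (left_quotient R L)"
    then obtain b where b: "y = L +>\<^bsub>R\<^esub> b" "b \<in> carrier R" unfolding car by blast
    show "r \<odot>\<^bsub>left_quotient R L\<^esub> (x \<oplus>\<^bsub>left_quotient R L\<^esub> y) =
        r \<odot>\<^bsub>left_quotient R L\<^esub> x \<oplus>\<^bsub>left_quotient R L\<^esub> r \<odot>\<^bsub>left_quotient R L\<^esub> y"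
      using r a(2) b(2) by (simp add: a(1) b(1) sm add R.r_distr)
  next
    fix r s x
    assume rs: "r \<in> carrier R" "s \<in> carrier R"
    assume "x \<in> carrier (left_quotient R L)"
    then obtain a where a: "x = L +>\<^bsub>R\<^esub> a" "a \<in> carrier R" unfolding car by blast
    show "(r \<oplus>\<^bsub>R\<^esub> s) \<odot>\<^bsub>left_quotient R L\<^esub> x =
        r \<odot>\<^bsub>left_quotient R L\<^esub> x \<oplus>\<^bsub>left_quotient R L\<^esub> s \<odot>\<^bsub>left_quotient R L\<^esub> x"
      using rs a(2) by (simp add: a(1) sm add R.l_distr)
    show "(r \<otimes>\<^bsub>R\<^esub> s) \<odot>\<^bsub>left_quotient R L\<^esub> x =
        r \<odot>\<^bsub>left_quotient R L\<^esub> (s \<odot>\<^bsub>left_quotient R L\<^esub> x)"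
      using rs a(2) by (simp add: a(1) sm R.m_assoc)
  next
    fix x
    assume "x \<in> carrier (left_quotient R L)"
    then obtain a where a: "x = L +>\<^bsub>R\<^esub> a" "a \<in> carrier R" unfolding car by blast
    show "\<one>\<^bsub>R\<^esub> \<odot>\<^bsub>left_quotient R L\<^esub> x = x"
      using a(2) by (simp add: a(1) sm)
  qed
qed

lemma left_module_cyclic_quotient:
  assumes "ring R" "a \<in> carrier R" shows "left_module R (cyclic_quotient R a)"
proof -
  interpret R: ring R by fact
  show ?thesis
  proof (rule left_module_left_quotient[OF assms(1)])
    show "additive_subgroup (PIdl\<^bsub>R\<^esub> a) R"
    proof (rule additive_subgroup.intro, rule R.add.subgroupI)
      show "PIdl\<^bsub>R\<^esub> a \<subseteq> carrier R" "PIdl\<^bsub>R\<^esub> a \<noteq> {}"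
        using assms(2) by (auto simp: cgenideal_def)
      fix b assume "b \<in> PIdl\<^bsub>R\<^esub> a"
      then obtain r where r: "r \<in> carrier R" "b = r \<otimes>\<^bsub>R\<^esub> a"
        by (auto simp: cgenideal_def)
      then have "\<ominus>\<^bsub>R\<^esub> b = (\<ominus>\<^bsub>R\<^esub> r) \<otimes>\<^bsub>R\<^esub> a"
        using assms(2) by (simp add: R.l_minus)
      then show "\<ominus>\<^bsub>R\<^esub> b \<in> PIdl\<^bsub>R\<^esub> a"
        using r(1) unfolding cgenideal_def by blast
      fix b' assume "b' \<in> PIdl\<^bsub>R\<^esub> a"
      then obtain r' where r': "r' \<in> carrier R" "b' = r' \<otimes>\<^bsub>R\<^esub> a"
        by (auto simp: cgenideal_def)
      have "b \<oplus>\<^bsub>R\<^esub> b' = (r \<oplus>\<^bsub>R\<^esub> r') \<otimes>\<^bsub>R\<^esub> a"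
        using r r' assms(2) by (simp add: R.l_distr)
      then show "b \<oplus>\<^bsub>R\<^esub> b' \<in> PIdl\<^bsub>R\<^esub> a"
        using r(1) r'(1) unfolding cgenideal_def by blast
    qed
  next
    fix r l assume r: "r \<in> carrier R" and "l \<in> PIdl\<^bsub>R\<^esub> a"
    then obtain s where s: "s \<in> carrier R" "l = s \<otimes>\<^bsub>R\<^esub> a"
      by (auto simp: cgenideal_def)
    then have "r \<otimes>\<^bsub>R\<^esub> l = (r \<otimes>\<^bsub>R\<^esub> s) \<otimes>\<^bsub>R\<^esub> a"
      using r assms(2) by (simp add: R.m_assoc)
    then show "r \<otimes>\<^bsub>R\<^esub> l \<in> PIdl\<^bsub>R\<^esub> a"
      using r s(1) unfolding cgenideal_def by blast
  qed
qed

end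

theory Submission
  imports Defs
begin

text \<open>
  Let \<open>x = g + c\<close> with \<open>g\<close> in the Lie algebra and \<open>c\<close> a scalar. An element \<open>a\<close> annihilates
  \<open>U/Ux\<close> iff \<open>aU \<subseteq> Ux\<close>, so the annihilator \<open>J\<close> is a two-sided ideal contained in the left
  ideal \<open>Ux\<close>. It vanishes as soon as \<open>z = [y, g]\<close> is not a multiple of \<open>g\<close> for some \<open>y\<close>,
  whatever \<open>c\<close> is, for the following reason.

  By the Poincare-Birkhoff-Witt theorem the associated graded ring of \<open>U\<close> is the polynomial ring
  in a basis of the Lie algebra; choose the basis to begin with \<open>g, z\<close>. Principal symbols of
  elements of \<open>J\<close> are divisible by the variable \<open>g\<close>, because \<open>J \<subseteq> Ux\<close>. On the other hand \<open>J\<close>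
  is stable under the commutator with \<open>y\<close>, which acts on principal symbols by the derivation \<open>D\<close>
  that extends \<open>ad y\<close>. If \<open>J \<noteq> 0\<close>, take a monomial \<open>g^k m\<close>, with \<open>m\<close> free of \<open>g\<close>, that occurs
  in a principal symbol of an element of \<open>J\<close> and has the least possible exponent \<open>k\<close>; then
  \<open>k \<ge> 1\<close>. From \<open>D (g^k m) = k g^(k-1) z m + g^k D m\<close> one sees that \<open>g^(k-1) z m\<close> occurs in the
  image of this symbol under \<open>D\<close>, since \<open>k \<noteq> 0\<close> in characteristic zero. This contradicts the choice
  of \<open>k\<close>. The argument is \<open>cyclic_annihilator_trivial\<close>, with \<open>lower_degree_quotient\<close> for the
  divisibility and \<open>lookup_poly_der\<close> for the coefficient.

  The elements \<open>g + c\<close> with \<open>[y, g] \<notin> Kg\<close> for some \<open>y\<close> form an open set: its complement is the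
  zero locus of the \<open>2 \<times> 2\<close> minors of the pairs \<open>(g, [y, g])\<close>, and the coordinates of \<open>g\<close>
  are functions on \<open>U\<^sub>1\<close> because the Lie algebra embeds into \<open>U\<close>. It is nonempty when the bracket is
  not zero: were every vector an eigenvector of every \<open>ad y\<close>, then \<open>[x, y]\<close> would be
  a multiple both of \<open>x\<close> and of \<open>y\<close>, which is only possible for \<open>[x, y] = 0\<close>.

  All computations take place in the free algebra modulo the enveloping ideal. The
  Poincare-Birkhoff-Witt theorem is needed in two halves. The Lie algebra acts on polynomials so that
  \<open>y\<close> acts as multiplication by \<open>y\<close> up to terms of lower degree (\<open>lie_act_commute\<close>,
  \<open>lie_act_leading\<close>), hence principal symbols are well defined modulo the enveloping ideal
  (\<open>symbol_enveloping_ideal\<close>). Conversely, straightening words shows that an element whose principal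
  symbol vanishes is congruent to one of lower degree (\<open>mod_lower_if_symbol_deg_below\<close>).
\<close>

section \<open>Linear maps between spaces of finitely supported functions\<close>

text \<open>
  Scalar multiplication is written as multiplication by a constant, so that polynomials and elements of
  the free algebra are treated alike.
\<close>

abbreviation cst :: "'k::comm_ring_1 \<Rightarrow> ('a::monoid_add \<Rightarrow>\<^sub>0 'k)" where
  "cst c \<equiv> Poly_Mapping.single 0 c"

lemma lookup_cst_mult [simp]:
  "Poly_Mapping.lookup (cst c * p) m = c * Poly_Mapping.lookup p m"
  unfolding mult_map_scale_conv_mult[symmetric]
  by (transfer fixing: c) (simp add: when_def)

lemma poly_mapping_add_induct [case_names single add]:
  fixes p :: "'a \<Rightarrow>\<^sub>0 'k::comm_monoid_add"
  assumes "\<And>m c. P (Poly_Mapping.single m c)" and "\<And>p q. P p \<Longrightarrow> P q \<Longrightarrow> P (p + q)"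
  shows "P p"
proof (induction p rule: update_induct)
  case const
  show ?case using assms(1)[of undefined 0] by simp
next
  case (update f a b)
  have "Poly_Mapping.update a b f = Poly_Mapping.single a b + f"
    using update(1) by (auto intro!: poly_mapping_eqI simp: lookup_update lookup_add lookup_single when_def in_keys_iff)
  then show ?case using assms update by simp
qed

lemma cst_commute: "cst c * p = p * cst c"
  for p :: "'a::monoid_add \<Rightarrow>\<^sub>0 'k::comm_ring_1"
  by (induction p rule: poly_mapping_add_induct)
    (simp_all add: mult_single mult.commute distrib_left distrib_right)

lemma cst_add_mult: "cst (a + b) * p = cst a * p + cst b * p"
  for p :: "'a::monoid_add \<Rightarrow>\<^sub>0 'k::comm_ring_1"
  by (simp add: single_add distrib_right)

lemma cst_cst_mult: "cst (a * b) * p = cst a * (cst b * p)"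
  for p :: "'a::monoid_add \<Rightarrow>\<^sub>0 'k::comm_ring_1"
  by (simp add: mult_single flip: mult.assoc)

lemma cst_left_commute: "q * (cst c * p) = cst c * (q * p)"
  for p :: "'a::monoid_add \<Rightarrow>\<^sub>0 'k::comm_ring_1"
  by (metis cst_commute mult.assoc)

lemma cst_mult_single: "cst c * Poly_Mapping.single m 1 = Poly_Mapping.single m c"
  for c :: "'k::comm_ring_1"
  by (simp add: mult_single)

text \<open>
  The linear extension of a map that is given on the basis of one-point functions.
\<close>

definition lin_ext :: "('a \<Rightarrow> ('b::monoid_add \<Rightarrow>\<^sub>0 'k)) \<Rightarrow> ('a \<Rightarrow>\<^sub>0 'k::comm_ring_1) \<Rightarrow> ('b \<Rightarrow>\<^sub>0 'k)" where
  "lin_ext f p = (\<Sum>m\<in>Poly_Mapping.keys p. cst (Poly_Mapping.lookup p m) * f m)"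

lemma lin_ext_superset:
  assumes "finite A" "Poly_Mapping.keys p \<subseteq> A"
  shows "lin_ext f p = (\<Sum>m\<in>A. cst (Poly_Mapping.lookup p m) * f m)"
  unfolding lin_ext_def using assms
  by (intro sum.mono_neutral_left) (auto simp: in_keys_iff)

lemma lin_ext_zero [simp]: "lin_ext f 0 = 0"
  by (simp add: lin_ext_def)

lemma lin_ext_single [simp]: "lin_ext f (Poly_Mapping.single m c) = cst c * f m"
  by (simp add: lin_ext_def)

lemma lin_ext_add: "lin_ext f (p + q) = lin_ext f p + lin_ext f q"
proof -
  let ?A = "Poly_Mapping.keys p \<union> Poly_Mapping.keys q"
  have "lin_ext f r = (\<Sum>m\<in>?A. cst (Poly_Mapping.lookup r m) * f m)" if "r \<in> {p, q, p + q}" for r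
    using that keys_add[of p q] by (intro lin_ext_superset) auto
  then show ?thesis
    by (simp add: lookup_add cst_add_mult sum.distrib)
qed

lemma lin_ext_cst: "lin_ext f (cst c * p) = cst c * lin_ext f p"
  for p :: "'a::monoid_add \<Rightarrow>\<^sub>0 'k::comm_ring_1"
proof -
  have "lin_ext f (cst c * p) = (\<Sum>m\<in>Poly_Mapping.keys p. cst (c * Poly_Mapping.lookup p m) * f m)"
    by (subst lin_ext_superset[of "Poly_Mapping.keys p"]) (auto simp: in_keys_iff)
  then show ?thesis
    by (simp add: lin_ext_def cst_cst_mult sum_distrib_left)
qed

lemma lin_ext_uminus: "lin_ext f (- p) = - lin_ext f p"
  using lin_ext_add[of f p "- p"] by (simp add: eq_neg_iff_add_eq_0 add.commute)

lemma lin_ext_diff: "lin_ext f (p - q) = lin_ext f p - lin_ext f q"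
  using lin_ext_add[of f p "- q"] by (simp add: lin_ext_uminus)

lemma lin_ext_sum: "lin_ext f (sum g A) = (\<Sum>x\<in>A. lin_ext f (g x))"
  by (induction A rule: infinite_finite_induct) (auto simp: lin_ext_add)

text \<open>
  This turns a multiplicative map on exponents into an algebra homomorphism; it is the universal property
  of a monoid algebra.
\<close>

lemma lin_ext_mult:
  fixes f :: "'a::monoid_add \<Rightarrow> ('b::monoid_add \<Rightarrow>\<^sub>0 'k::comm_ring_1)"
  assumes "\<And>v w. f (v + w) = f v * f w"
  shows "lin_ext f (p * q) = lin_ext f p * lin_ext f q"
proof (induction p rule: poly_mapping_add_induct)
  case (single v a)
  show ?case
  proof (induction q rule: poly_mapping_add_induct)
    case (single w b)
    have "cst (a * b) * (f v * f w) = cst a * f v * (cst b * f w)"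
      by (metis cst_cst_mult cst_left_commute mult.assoc)
    then show ?case by (simp add: mult_single assms)
  qed (simp add: lin_ext_add distrib_left)
qed (simp add: lin_ext_add distrib_right)

lemma lin_ext_single_id: "lin_ext (\<lambda>m. Poly_Mapping.single m 1) p = p"
  by (induction p rule: poly_mapping_add_induct) (simp_all add: lin_ext_add cst_mult_single)

text \<open>
  One notion of degree serves both algebras: for polynomials \<open>s\<close> is the size of a multiset of variables,
  for the free algebra it is the length of a word. The bound is strict in order that degree below \<open>0\<close>
  means zero, so that inductions on the degree can start there.
\<close>

definition deg_below :: "('a \<Rightarrow> nat) \<Rightarrow> nat \<Rightarrow> ('a \<Rightarrow>\<^sub>0 'k::comm_ring_1) set" where
  "deg_below s d = {p. \<forall>m\<in>Poly_Mapping.keys p. s m < d}"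

lemma deg_below_iff_lookup: "p \<in> deg_below s d \<longleftrightarrow> (\<forall>m. d \<le> s m \<longrightarrow> Poly_Mapping.lookup p m = 0)"
  unfolding deg_below_def Ball_def in_keys_iff mem_Collect_eq by (meson not_le)

lemma deg_below_mono: "p \<in> deg_below s d \<Longrightarrow> d \<le> e \<Longrightarrow> p \<in> deg_below s e"
  by (auto simp: deg_below_def)

lemma deg_below_zero [simp]: "0 \<in> deg_below s d"
  by (simp add: deg_below_def)

lemma deg_below_0 [simp]: "p \<in> deg_below s 0 \<longleftrightarrow> p = 0"
  by (auto simp: deg_below_iff_lookup intro!: poly_mapping_eqI)

lemma deg_below_add: "p \<in> deg_below s d \<Longrightarrow> q \<in> deg_below s d \<Longrightarrow> p + q \<in> deg_below s d"
  by (simp add: deg_below_iff_lookup lookup_add)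

lemma deg_below_uminus: "p \<in> deg_below s d \<Longrightarrow> - p \<in> deg_below s d"
  by (simp add: deg_below_iff_lookup)

lemma deg_below_diff: "p \<in> deg_below s d \<Longrightarrow> q \<in> deg_below s d \<Longrightarrow> p - q \<in> deg_below s d"
  by (simp add: deg_below_iff_lookup lookup_minus)

lemma deg_below_sum: "(\<And>x. x \<in> A \<Longrightarrow> g x \<in> deg_below s d) \<Longrightarrow> sum g A \<in> deg_below s d"
  by (induction A rule: infinite_finite_induct) (auto simp: deg_below_add)

lemma deg_below_cst: "p \<in> deg_below s d \<Longrightarrow> cst c * p \<in> deg_below s d"
  by (simp add: deg_below_iff_lookup)

lemma deg_below_single: "s m < d \<Longrightarrow> Poly_Mapping.single m c \<in> deg_below s d"
  by (simp add: deg_below_def)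

lemma deg_below_lin_ext: "p \<in> deg_below s d \<Longrightarrow> (\<And>m. s m < d \<Longrightarrow> f m \<in> deg_below s' e) \<Longrightarrow> lin_ext f p \<in> deg_below s' e"
  unfolding lin_ext_def by (intro deg_below_sum deg_below_cst) (auto simp: deg_below_def)

text \<open>
  Strict bounds do not add up; one of the two factors is bounded by \<open>Suc k\<close>, that is, by \<open>\<le> k\<close>.
\<close>

lemma deg_below_mult_left:
  assumes "\<And>v w. s (v + w) = s v + s w" "p \<in> deg_below s (Suc k)" "q \<in> deg_below s e"
  shows "p * q \<in> deg_below s (k + e)"
  unfolding deg_below_def
proof safe
  fix m assume "m \<in> Poly_Mapping.keys (p * q)"
  then obtain a b where "m = a + b" "a \<in> Poly_Mapping.keys p" "b \<in> Poly_Mapping.keys q"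
    using keys_mult[of p q] by blast
  moreover have "s a < Suc k" "s b < e" using calculation assms unfolding deg_below_def by auto
  ultimately show "s m < k + e" using assms(1) by simp
qed

lemma lin_ext_cong_deg_below:
  "p \<in> deg_below s d \<Longrightarrow> (\<And>m. s m < d \<Longrightarrow> f m = g m) \<Longrightarrow> lin_ext f p = lin_ext g p"
  unfolding lin_ext_def by (rule sum.cong) (auto simp: deg_below_def)

lemma lin_ext_fun_diff: "lin_ext (\<lambda>m. f m - g m) p = lin_ext f p - lin_ext g p"
  by (simp add: lin_ext_def right_diff_distrib sum_subtractf)

lemma lin_ext_lin_ext: "lin_ext f (lin_ext g p) = lin_ext (\<lambda>m. lin_ext f (g m)) p"
  for g :: "'a \<Rightarrow> 'b::monoid_add \<Rightarrow>\<^sub>0 'k::comm_ring_1"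
  by (simp add: lin_ext_def[of g] lin_ext_sum lin_ext_cst lin_ext_def[of "\<lambda>m. lin_ext f (g m)"])

lemma lin_ext_mult_left: "q * lin_ext f p = lin_ext (\<lambda>m. q * f m) p"
  by (simp add: lin_ext_def sum_distrib_left cst_left_commute[of q])

lemma lin_ext_mult_right: "lin_ext f p * q = lin_ext (\<lambda>m. f m * q) p"
  by (simp add: lin_ext_def sum_distrib_right mult.assoc)

lemma ex_deg_below: "\<exists>d. p \<in> deg_below s d"
  by (intro exI[of _ "Suc (Max (s ` Poly_Mapping.keys p))"]) (auto simp: deg_below_def less_Suc_eq_le)

lemma deg_below_mult_right:
  assumes "\<And>v w. s (v + w) = s v + s w" "p \<in> deg_below s d" "q \<in> deg_below s (Suc k)"
  shows "p * q \<in> deg_below s (d + k)"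
  unfolding deg_below_def
proof safe
  fix m assume "m \<in> Poly_Mapping.keys (p * q)"
  then obtain a b where "m = a + b" "a \<in> Poly_Mapping.keys p" "b \<in> Poly_Mapping.keys q"
    using keys_mult[of p q] by blast
  moreover have "s a < d" "s b < Suc k" using calculation assms unfolding deg_below_def by auto
  ultimately show "s m < d + k" using assms(1) by simp
qed

section \<open>The Poincare-Birkhoff-Witt action\<close>

text \<open>
  Polynomials are functions on multisets of indices of basis vectors; the degree of a monomial is the size
  of the multiset, and the smallest variable is its minimum.
\<close>

abbreviation mon :: "nat multiset \<Rightarrow> nat multiset \<Rightarrow>\<^sub>0 'k::field" where
  "mon m \<equiv> Poly_Mapping.single m 1"

context lie_algebra
begin

lemma bracket_add_left: "bracket (x + y) z = bracket x z + bracket y z"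
  using bracket_linear_left[of z] module_hom.add[of scale scale "\<lambda>x. bracket x z"]
  by (simp add: Vector_Spaces.linear_def)

lemma bracket_add_right: "bracket z (x + y) = bracket z x + bracket z y"
  using bracket_linear_right[of z] module_hom.add[of scale scale "bracket z"]
  by (simp add: Vector_Spaces.linear_def)

lemma bracket_scale_left: "bracket (scale c x) z = scale c (bracket x z)"
  using bracket_linear_left[of z] module_hom.scale[of scale scale "\<lambda>x. bracket x z"]
  by (simp add: Vector_Spaces.linear_def)

lemma bracket_scale_right: "bracket z (scale c x) = scale c (bracket z x)"
  using bracket_linear_right[of z] module_hom.scale[of scale scale "bracket z"]
  by (simp add: Vector_Spaces.linear_def)

lemma bracket_antisym: "bracket x y = - bracket y x"
proof -
  have "bracket y x + bracket x y = 0"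
    using bracket_self[of "x + y"] by (simp add: bracket_add_left bracket_add_right bracket_self[of x] bracket_self[of y] add.commute)
  then show ?thesis by (simp add: eq_neg_iff_add_eq_0 add.commute)
qed

lemma bracket_uminus_left: "bracket (- x) y = - bracket x y"
  using bracket_scale_left[of "-1" x y] by simp

text \<open>
  The Jacobi identity in the form in which \<open>ad\<close> is a derivation.
\<close>

lemma bracket_bracket_left: "bracket (bracket x y) z = bracket x (bracket y z) + bracket (bracket x z) y"
proof -
  have "bracket y (bracket z x) = bracket (bracket x z) y"
    by (metis bracket_antisym bracket_uminus_left)
  then have "bracket x (bracket y z) + bracket (bracket x z) y = - bracket z (bracket x y)"
    using jacobi[of x y z] by (simp add: eq_neg_iff_add_eq_0 ac_simps)
  then show ?thesis
    using bracket_antisym[of "bracket x y" z] by simp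
qed

end

text \<open>
  Basis vectors are indexed by natural numbers because the construction of the action orders them; the
  indices beyond \<open>n\<close> are variables of the polynomial ring without a meaning in the Lie algebra.
\<close>

locale lie_algebra_basis = lie_algebra scale bracket
  for scale :: "'k::field \<Rightarrow> 'g::ab_group_add \<Rightarrow> 'g" and bracket +
  fixes n :: nat and b :: "nat \<Rightarrow> 'g" and coord :: "nat \<Rightarrow> 'g \<Rightarrow> 'k"
  assumes coord_add: "coord i (x + y) = coord i x + coord i y"
    and coord_scale: "coord i (scale c x) = c * coord i x"
    and coord_b: "j < n \<Longrightarrow> coord i (b j) = (if i = j then 1 else 0)"
    and expand: "x = (\<Sum>i<n. scale (coord i x) (b i))"
begin

lemma eq_if_eq_on_basis:
  fixes f h :: "'g \<Rightarrow> ('a::monoid_add \<Rightarrow>\<^sub>0 'k)"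
  assumes f: "\<And>x y. f (x + y) = f x + f y" "\<And>c x. f (scale c x) = cst c * f x"
    and h: "\<And>x y. h (x + y) = h x + h y" "\<And>c x. h (scale c x) = cst c * h x"
    and eq: "\<And>i. i < n \<Longrightarrow> f (b i) = h (b i)"
  shows "f y = h y"
proof -
  have sum: "F (sum g (A :: nat set)) = (\<Sum>i\<in>A. F (g i))"
    if "\<And>x y. F (x + y) = F x + F y" "\<And>c x. F (scale c x) = cst c * F x"
    for F :: "'g \<Rightarrow> ('a::monoid_add \<Rightarrow>\<^sub>0 'k)" and g A
    using that(2)[of 0 0] by (induction A rule: infinite_finite_induct) (auto simp: that(1))
  have "f y = f (\<Sum>i<n. scale (coord i y) (b i))" by (simp flip: expand)
  also have "\<dots> = h (\<Sum>i<n. scale (coord i y) (b i))"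
    by (simp add: sum[of f] sum[of h] f h eq)
  finally show ?thesis by (simp flip: expand)
qed

text \<open>
  The action of the \<open>i\<close>-th basis vector on the monomial \<open>m\<close> is multiplication if \<open>i\<close> is at most every
  variable in \<open>m\<close>. Otherwise \<open>m\<close> is \<open>j N\<close> with \<open>j < i\<close> minimal, and the wanted
  relation forces the value \<open>j (i N) + [i, j] N\<close>. Here \<open>i N\<close> is the monomial \<open>i N\<close> plus terms of
  degree at most that of \<open>N\<close>, and \<open>j\<close> acts on that monomial by multiplication. Written out this way the
  definition calls itself on polynomials of smaller degree only; since those are arbitrary polynomials,
  the recursion is on a bound \<open>d\<close> for the degree instead of on \<open>m\<close>.
\<close>

primrec rho_upto :: "nat \<Rightarrow> nat \<Rightarrow> nat multiset \<Rightarrow> (nat multiset \<Rightarrow>\<^sub>0 'k)" where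
  "rho_upto 0 i m = mon (add_mset i m)"
| "rho_upto (Suc d) i m =
    (if size m \<le> d then rho_upto d i m
     else if \<forall>j\<in>#m. i \<le> j then mon (add_mset i m)
     else let j = Min_mset m; N = m - {#j#} in
       mon (add_mset i m) + lin_ext (rho_upto d j) (rho_upto d i N - mon (add_mset i N))
       + (\<Sum>k<n. cst (coord k (bracket (b i) (b j))) * rho_upto d k N))"

definition rho :: "nat \<Rightarrow> nat multiset \<Rightarrow> (nat multiset \<Rightarrow>\<^sub>0 'k)" where
  "rho i m = rho_upto (size m) i m"

definition lie_act :: "'g \<Rightarrow> (nat multiset \<Rightarrow>\<^sub>0 'k) \<Rightarrow> (nat multiset \<Rightarrow>\<^sub>0 'k)" where
  "lie_act y p = (\<Sum>k<n. cst (coord k y) * lin_ext (rho k) p)"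

text \<open>
  The degree bound in the recursion does not affect the value once it is large enough.
\<close>

lemma rho_upto_eq: "size m \<le> d \<Longrightarrow> rho_upto d i m = rho i m"
proof (induction d)
  case (Suc d)
  then show ?case
    by (cases "size m \<le> d") (auto simp: rho_def le_Suc_eq)
qed (simp add: rho_def)

lemma rho_minimal: "\<forall>j\<in>#m. i \<le> j \<Longrightarrow> rho i m = mon (add_mset i m)"
  by (cases "size m") (auto simp: rho_def)

lemma rho_add_mset_aux:
  assumes "j < i" "\<forall>k\<in>#N. j \<le> k"
  shows "rho i (add_mset j N) = mon (add_mset i (add_mset j N))
    + lin_ext (rho_upto (size N) j) (rho i N - mon (add_mset i N))
    + (\<Sum>k<n. cst (coord k (bracket (b i) (b j))) * rho k N)"
proof -
  have "Min_mset (add_mset j N) = j"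
    using assms by (intro Min_eqI) auto
  then show ?thesis
    using assms by (auto simp: rho_def Let_def)
qed

text \<open>
  The action of a basis vector is multiplication by its variable up to terms of lower degree. This is proved
  before the recursion equation \<open>rho_add_mset\<close>, because the equation depends on it: only when the
  correction terms have small degree does the degree-bounded action agree with the real one on them.
\<close>

lemma rho_leading: "rho i m - mon (add_mset i m) \<in> deg_below size (Suc (size m))"
proof (induction "size m" arbitrary: i m rule: less_induct)
  case less
  show ?case
  proof (cases "\<forall>j\<in>#m. i \<le> j")
    case True
    then show ?thesis by (simp add: rho_minimal)
  next
    case False
    define j where "j = Min_mset m"
    define N where "N = m - {#j#}"
    have j: "j \<in># m" "\<forall>k\<in>#m. j \<le> k"
      using False unfolding j_def by (auto intro: Min_in)
    then have m: "m = add_mset j N" by (simp add: N_def)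
    have ji: "j < i" using False j by (meson le_less_trans not_le)
    have rho: "rho k m' \<in> deg_below size (Suc (size m))" if "size m' < size m" for k m'
    proof -
      have "rho k m' = (rho k m' - mon (add_mset k m')) + mon (add_mset k m')" by simp
      also have "\<dots> \<in> deg_below size (Suc (size m))"
        using less[OF that, of k] that by (intro deg_below_add deg_below_single) (auto intro: deg_below_mono)
      finally show ?thesis .
    qed
    have "lin_ext (rho_upto (size N) j) (rho i N - mon (add_mset i N)) \<in> deg_below size (Suc (size m))"
    proof (rule deg_below_lin_ext)
      show "rho i N - mon (add_mset i N) \<in> deg_below size (size m)"
        using less[of N i] m by simp
      show "rho_upto (size N) j m' \<in> deg_below size (Suc (size m))" if "size m' < size m" for m'
        using rho[OF that] that m by (simp add: rho_upto_eq)
    qed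
    moreover have "(\<Sum>k<n. cst (coord k (bracket (b i) (b j))) * rho k N) \<in> deg_below size (Suc (size m))"
      using m by (intro deg_below_sum deg_below_cst rho) simp
    moreover have "\<forall>k\<in>#N. j \<le> k" using j m by simp
    ultimately show ?thesis
      using rho_add_mset_aux[OF ji] m by (simp add: deg_below_add)
  qed
qed

lemma lie_act_b: "i < n \<Longrightarrow> lie_act (b i) p = lin_ext (rho i) p"
proof -
  assume "i < n"
  then have "lie_act (b i) p = (\<Sum>k<n. if k = i then lin_ext (rho k) p else 0)"
    unfolding lie_act_def by (intro sum.cong) (auto simp: coord_b)
  then show ?thesis using \<open>i < n\<close> by simp
qed

lemma lie_act_mon: "lie_act y (mon m) = (\<Sum>k<n. cst (coord k y) * rho k m)"
  by (simp add: lie_act_def)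

lemma lie_act_add_left: "lie_act (y + z) p = lie_act y p + lie_act z p"
  by (simp add: lie_act_def coord_add cst_add_mult sum.distrib)

lemma lie_act_scale_left: "lie_act (scale c y) p = cst c * lie_act y p"
  by (simp add: lie_act_def coord_scale cst_cst_mult sum_distrib_left)

lemma lie_act_zero_left [simp]: "lie_act 0 p = 0"
  using lie_act_scale_left[of 0 0] by simp

lemma lie_act_uminus_left: "lie_act (- y) p = - lie_act y p"
  using lie_act_add_left[of y "- y" p] by (simp add: eq_neg_iff_add_eq_0 add.commute)

lemma lie_act_add: "lie_act y (p + q) = lie_act y p + lie_act y q"
  by (simp add: lie_act_def lin_ext_add distrib_left sum.distrib)

lemma lie_act_cst: "lie_act y (cst c * p) = cst c * lie_act y p"
  unfolding lie_act_def lin_ext_cst sum_distrib_left by (intro sum.cong refl cst_left_commute)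

lemma lie_act_zero [simp]: "lie_act y 0 = 0"
  by (simp add: lie_act_def)

text \<open>
  The defining relation \<open>i (j N) = j (i N) + [i, j] N\<close>.
\<close>

lemma rho_add_mset:
  assumes "j < i" "\<forall>k\<in>#N. j \<le> k"
  shows "rho i (add_mset j N) = lin_ext (rho j) (rho i N) + lie_act (bracket (b i) (b j)) (mon N)"
proof -
  have "lin_ext (rho_upto (size N) j) (rho i N - mon (add_mset i N))
      = lin_ext (rho j) (rho i N - mon (add_mset i N))"
    using rho_leading[of i N] by (rule lin_ext_cong_deg_below) (simp add: rho_upto_eq)
  moreover have "rho j (add_mset i N) = mon (add_mset i (add_mset j N))"
    using assms by (subst rho_minimal) (auto simp: add_mset_commute)
  ultimately show ?thesis
    unfolding rho_add_mset_aux[OF assms] by (simp add: lin_ext_diff lie_act_mon)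
qed

text \<open>
  For a variable \<open>l\<close> below all of \<open>M\<close> the commutation relation with \<open>l\<close> at \<open>M\<close> holds for every \<open>y\<close>. For
  basis vectors \<open>i > l\<close> it is the definition, and for \<open>i < l\<close> the definition of \<open>l (i M)\<close> read backwards.
\<close>

lemma lie_act_add_mset_minimal:
  assumes "l < n" "\<forall>k\<in>#M. l \<le> k"
  shows "lie_act y (mon (add_mset l M)) = lie_act (b l) (lie_act y (mon M)) + lie_act (bracket y (b l)) (mon M)"
proof (rule eq_if_eq_on_basis[where y = y])
  fix i assume i: "i < n"
  have "lin_ext (rho i) (mon (add_mset l M)) = lin_ext (rho l) (rho i M) + lie_act (bracket (b i) (b l)) (mon M)"
  proof (cases i l rule: linorder_cases)
    case greater
    then show ?thesis using assms by (simp add: rho_add_mset)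
  next
    case equal
    then show ?thesis using assms by (simp add: rho_minimal bracket_self)
  next
    case less
    then have M: "\<forall>k\<in>#M. i \<le> k" using assms by force
    have "rho l (add_mset i M) = lin_ext (rho i) (rho l M) + lie_act (bracket (b l) (b i)) (mon M)"
      using less M by (rule rho_add_mset)
    moreover have "\<forall>k\<in>#add_mset l M. i \<le> k" using less M by auto
    ultimately show ?thesis
      using less M assms bracket_antisym[of "b l" "b i"] by (simp add: rho_minimal lie_act_uminus_left)
  qed
  then show "lie_act (b i) (mon (add_mset l M)) =
      lie_act (b l) (lie_act (b i) (mon M)) + lie_act (bracket (b i) (b l)) (mon M)"
    using i assms by (simp add: lie_act_b)
qed (simp_all add: lie_act_add_left lie_act_scale_left lie_act_add lie_act_cst bracket_add_left bracket_scale_left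
    distrib_left)

definition commute_at :: "'g \<Rightarrow> 'g \<Rightarrow> (nat multiset \<Rightarrow>\<^sub>0 'k) \<Rightarrow> bool" where
  "commute_at y z p \<longleftrightarrow> lie_act y (lie_act z p) = lie_act z (lie_act y p) + lie_act (bracket y z) p"

lemma commute_at_sym: "commute_at y z p \<Longrightarrow> commute_at z y p"
  using bracket_antisym[of y z] by (simp add: commute_at_def lie_act_uminus_left)

lemma commute_at_add: "commute_at y z p \<Longrightarrow> commute_at y z q \<Longrightarrow> commute_at y z (p + q)"
  by (simp add: commute_at_def lie_act_add)

lemma commute_at_cst: "commute_at y z p \<Longrightarrow> commute_at y z (cst c * p)"
  by (simp add: commute_at_def lie_act_cst distrib_left)

lemma commute_at_deg_below:
  assumes "p \<in> deg_below s d" "\<And>m. s m < d \<Longrightarrow> commute_at y z (mon m)"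
  shows "commute_at y z p"
proof -
  have sum: "commute_at y z (sum g S)" if "\<And>x. x \<in> S \<Longrightarrow> commute_at y z (g x)"
    for g :: "nat multiset \<Rightarrow> (nat multiset \<Rightarrow>\<^sub>0 'k)" and S
    using that by (induction S rule: infinite_finite_induct) (auto simp: commute_at_add, simp_all add: commute_at_def)
  have "commute_at y z (lin_ext mon p)"
    unfolding lin_ext_def using assms by (intro sum commute_at_cst) (auto simp: deg_below_def)
  then show ?thesis by (simp add: lin_ext_single_id)
qed

lemma commute_at_if_on_basis:
  assumes "\<And>i j. i < n \<Longrightarrow> j < n \<Longrightarrow> commute_at (b i) (b j) p"
  shows "commute_at y z p"
proof -
  note lin_ext = lie_act_add_left lie_act_scale_left lie_act_add lie_act_cst bracket_add_left bracket_scale_left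
    bracket_add_right bracket_scale_right distrib_left
  have on_basis: "lie_act y (lie_act (b j) p) = lie_act (b j) (lie_act y p) + lie_act (bracket y (b j)) p" if j: "j < n" for j
  proof (rule eq_if_eq_on_basis[where y = y and f = "\<lambda>y. lie_act y (lie_act (b j) p)"
        and h = "\<lambda>y. lie_act (b j) (lie_act y p) + lie_act (bracket y (b j)) p"])
    show "lie_act (b i) (lie_act (b j) p) = lie_act (b j) (lie_act (b i) p) + lie_act (bracket (b i) (b j)) p" if "i < n" for i
      by (rule assms[OF that j, unfolded commute_at_def])
  qed (simp_all add: lin_ext add_ac)
  have "lie_act y (lie_act z p) = lie_act z (lie_act y p) + lie_act (bracket y z) p"
  proof (rule eq_if_eq_on_basis[where y = z and f = "\<lambda>z. lie_act y (lie_act z p)"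
        and h = "\<lambda>z. lie_act z (lie_act y p) + lie_act (bracket y z) p"])
    show "lie_act y (lie_act (b j) p) = lie_act (b j) (lie_act y p) + lie_act (bracket y (b j)) p" if "j < n" for j
      by (rule on_basis[OF that])
  qed (simp_all add: lin_ext add_ac)
  then show ?thesis by (simp add: commute_at_def)
qed

lemma commute_at_minimal:
  assumes "l < n" "\<forall>k\<in>#M. l \<le> k"
  shows "commute_at y (b l) (mon M)"
  using lie_act_add_mset_minimal[OF assms, of y] assms
  by (simp add: commute_at_def lie_act_b rho_minimal)

text \<open>
  The action is one of the Lie algebra. The proof is by induction on the degree: for \<open>i, j\<close> both above the
  minimal variable \<open>l\<close> of the monomial \<open>l M\<close>, both \<open>i\<close> and \<open>j\<close> are moved past \<open>l\<close>, the induction hypothesis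
  is applied at \<open>M\<close>, and the leftover double brackets cancel by the Jacobi identity.
\<close>

theorem lie_act_commute: "lie_act y (lie_act z p) = lie_act z (lie_act y p) + lie_act (bracket y z) p"
proof -
  have "commute_at y z (mon N)" for y z N
  proof (induction "size N" arbitrary: N y z rule: less_induct)
    case less
    show ?case
    proof (rule commute_at_if_on_basis)
      fix i j assume ij: "i < n" "j < n"
      consider "\<forall>k\<in>#N. j \<le> k" | "\<forall>k\<in>#N. i \<le> k" | "\<not> (\<forall>k\<in>#N. j \<le> k)" "\<not> (\<forall>k\<in>#N. i \<le> k)"
        by blast
      then show "commute_at (b i) (b j) (mon N)"
      proof cases
        case 1
        then show ?thesis using ij by (intro commute_at_minimal)
      next
        case 2
        then show ?thesis using ij by (intro commute_at_sym[OF commute_at_minimal])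
      next
        case 3
        define l where "l = Min_mset N"
        define M where "M = N - {#l#}"
        have l: "l \<in># N" "\<forall>k\<in>#N. l \<le> k"
          using 3 unfolding l_def by (auto intro: Min_in)
        then have N: "N = add_mset l M" by (simp add: M_def)
        have M: "\<forall>k\<in>#M. l \<le> k" using l N by simp
        have lij: "l < i" "l < j" using 3 l by (meson le_less_trans not_le)+
        then have ln: "l < n" using ij by simp
        have IH: "commute_at y z (mon M)" for y z using less N by simp
        have IH': "commute_at y z p" if "p \<in> deg_below size (size N)" for y z p
          using that less by (rule commute_at_deg_below)
        \<comment> \<open>\<open>j' M\<close> is not a monomial, but its leading monomial \<open>j' M\<close> has all variables \<open>\<ge> l\<close>,
          and the induction hypothesis applies to the rest, whose degree is at most that of \<open>M\<close>.\<close>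
        have past_l: "commute_at (b i') (b l) (lie_act (b j') (mon M))"
          if "i' < n" "j' < n" "l < j'" for i' j'
        proof -
          have "rho j' M - mon (add_mset j' M) \<in> deg_below size (size N)"
            using rho_leading[of j' M] N by simp
          then have "commute_at (b i') (b l) (rho j' M - mon (add_mset j' M) + mon (add_mset j' M))"
            using that M ln by (intro commute_at_add IH' commute_at_minimal) auto
          then show ?thesis using that by (simp add: lie_act_b)
        qed
        have step: "lie_act (b i') (lie_act (b j') (mon N)) = lie_act (b l) (lie_act (b i') (lie_act (b j') (mon M)))
            + lie_act (bracket (b i') (b l)) (lie_act (b j') (mon M)) + lie_act (b i') (lie_act (bracket (b j') (b l)) (mon M))"
          if "i' < n" "j' < n" "l < j'" for i' j'
          using past_l[OF that] unfolding N lie_act_add_mset_minimal[OF ln M] lie_act_add commute_at_def by simp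
        have c: "lie_act y (lie_act z (mon M)) = lie_act z (lie_act y (mon M)) + lie_act (bracket y z) (mon M)" for y z
          by (rule IH[unfolded commute_at_def])
        have jac: "lie_act (bracket (b i) (bracket (b j) (b l))) (mon M)
            + lie_act (bracket (bracket (b i) (b l)) (b j)) (mon M)
            = lie_act (bracket (bracket (b i) (b j)) (b l)) (mon M)"
          by (metis lie_act_add_left bracket_bracket_left)
        have "lie_act (b i) (lie_act (b j) (mon N)) - lie_act (b j) (lie_act (b i) (mon N))
          = lie_act (b l) (lie_act (b i) (lie_act (b j) (mon M))) - lie_act (b l) (lie_act (b j) (lie_act (b i) (mon M)))
            + lie_act (bracket (bracket (b i) (b l)) (b j)) (mon M)
            + lie_act (bracket (b i) (bracket (b j) (b l))) (mon M)"
          using c[of "bracket (b i) (b l)" "b j"] c[of "b i" "bracket (b j) (b l)"]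
          unfolding step[OF ij lij(2)] step[OF ij(2,1) lij(1)] by (simp add: algebra_simps)
        also have "\<dots> = lie_act (bracket (b i) (b j)) (mon N)"
          using jac unfolding N lie_act_add_mset_minimal[OF ln M] c[of "b i" "b j"] lie_act_add
          by (simp add: algebra_simps)
        finally show ?thesis by (simp add: commute_at_def algebra_simps)
      qed
    qed
  qed
  then have "commute_at y z p"
    by (intro commute_at_deg_below[of p size "Suc (Max (size ` Poly_Mapping.keys p))"])
      (auto simp: deg_below_def less_Suc_eq_le)
  then show ?thesis by (simp add: commute_at_def)
qed

end

section \<open>The enveloping algebra acting on polynomials\<close>

abbreviation word :: "'g list \<Rightarrow> ('k::field, 'g) free_alg" where
  "word l \<equiv> Poly_Mapping.single (Free_Word l) 1"

abbreviation len :: "'g free_word \<Rightarrow> nat" where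
  "len w \<equiv> length (letters w)"

lemma free_gen_mult_word: "free_gen y * word l = word (y # l)"
  by (simp add: free_gen_def mult_single plus_free_word_def)

lemma word_Nil: "word [] = 1"
  by (simp flip: zero_free_word_def)

lemma len_plus: "len (v + w) = len v + len w"
  by (simp add: plus_free_word_def)

lemma len_zero [simp]: "len 0 = 0"
  by (simp add: zero_free_word_def)

lemma enveloping_ideal_closed:
  fixes s t :: "('k::field, 'g::ab_group_add) free_alg"
  shows "(0 :: ('k, 'g) free_alg) \<in> enveloping_ideal scale bracket"
    and "s \<in> enveloping_ideal scale bracket \<Longrightarrow> t \<in> enveloping_ideal scale bracket
      \<Longrightarrow> s + t \<in> enveloping_ideal scale bracket"
    and "t \<in> enveloping_ideal scale bracket \<Longrightarrow> s * t \<in> enveloping_ideal scale bracket"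
    and "t \<in> enveloping_ideal scale bracket \<Longrightarrow> t * s \<in> enveloping_ideal scale bracket"
proof -
  interpret ideal "enveloping_ideal scale bracket" "free_ring :: ('k, 'g) free_alg ring"
    by (rule enveloping_ideal_ideal)
  show "(0 :: ('k, 'g) free_alg) \<in> enveloping_ideal scale bracket"
    "s \<in> enveloping_ideal scale bracket \<Longrightarrow> t \<in> enveloping_ideal scale bracket
      \<Longrightarrow> s + t \<in> enveloping_ideal scale bracket"
    "t \<in> enveloping_ideal scale bracket \<Longrightarrow> s * t \<in> enveloping_ideal scale bracket"
    "t \<in> enveloping_ideal scale bracket \<Longrightarrow> t * s \<in> enveloping_ideal scale bracket"
    using additive_subgroup.zero_closed[OF is_additive_subgroup]
      additive_subgroup.a_closed[OF is_additive_subgroup, of s t]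
      I_l_closed[of t s] I_r_closed[of t s]
    by (simp_all add: ring_of_type_algebra_def)
qed

text \<open>
  Negation is multiplication by \<open>-1\<close>, so closure under addition and multiplication on both sides suffices.
\<close>

lemma enveloping_ideal_least:
  fixes K :: "('k::field, 'g::ab_group_add) free_alg set"
  assumes "0 \<in> K" and add: "\<And>s t. s \<in> K \<Longrightarrow> t \<in> K \<Longrightarrow> s + t \<in> K"
    and left: "\<And>s t. t \<in> K \<Longrightarrow> s * t \<in> K" and right: "\<And>s t. t \<in> K \<Longrightarrow> t * s \<in> K"
    and relations: "enveloping_relations scale bracket \<subseteq> K"
  shows "enveloping_ideal scale bracket \<subseteq> K"
proof -
  interpret ring "free_ring :: ('k, 'g) free_alg ring" by (rule ring_free_ring)
  have "ideal K (free_ring :: ('k, 'g) free_alg ring)"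
  proof (rule idealI[OF ring_free_ring])
    show "subgroup K (add_monoid free_ring)"
    proof (rule add.subgroupI)
      show "K \<noteq> {}" using assms(1) by blast
      show "\<ominus>\<^bsub>free_ring\<^esub> s \<in> K" if "s \<in> K" for s
      proof -
        have "\<ominus>\<^bsub>free_ring\<^esub> s = - s"
          by (rule minus_equality) (simp_all add: ring_of_type_algebra_def)
        then show ?thesis using left[OF that, of "-1"] by simp
      qed
    qed (simp_all add: ring_of_type_algebra_def add)
  qed (simp_all add: ring_of_type_algebra_def left right)
  then show ?thesis
    unfolding enveloping_ideal_def using relations by (rule genideal_minimal)
qed

context lie_algebra_basis
begin

abbreviation I :: "('k, 'g) free_alg set" where
  "I \<equiv> enveloping_ideal scale bracket"

lemma I_zero [simp]: "0 \<in> I"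
  and I_add: "s \<in> I \<Longrightarrow> t \<in> I \<Longrightarrow> s + t \<in> I"
  and I_mult_left: "t \<in> I \<Longrightarrow> s * t \<in> I"
  and I_mult_right: "t \<in> I \<Longrightarrow> t * s \<in> I"
  by (fact enveloping_ideal_closed)+

lemma I_uminus: "t \<in> I \<Longrightarrow> - t \<in> I"
  using I_mult_left[of t "-1"] by simp

lemma I_diff: "s \<in> I \<Longrightarrow> t \<in> I \<Longrightarrow> s - t \<in> I"
  using I_add[of s "- t"] I_uminus by simp

lemma I_sum: "(\<And>x. x \<in> S \<Longrightarrow> g x \<in> I) \<Longrightarrow> sum g S \<in> I"
  by (induction S rule: infinite_finite_induct) (auto intro: I_add)

lemma I_relations:
  "free_gen (x + y) - free_gen x - free_gen y \<in> I"
  "free_gen (scale c x) - cst c * free_gen x \<in> I"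
  "free_gen x * free_gen y - free_gen y * free_gen x - free_gen (bracket x y) \<in> I"
proof -
  have "t \<in> I" if "t \<in> enveloping_relations scale bracket" for t
    using that unfolding enveloping_ideal_def genideal_def by blast
  then show "free_gen (x + y) - free_gen x - free_gen y \<in> I"
    "free_gen (scale c x) - cst c * free_gen x \<in> I"
    "free_gen x * free_gen y - free_gen y * free_gen x - free_gen (bracket x y) \<in> I"
    unfolding enveloping_relations_def free_scalar_def by blast+
qed

definition enveloping_act :: "('k, 'g) free_alg \<Rightarrow> (nat multiset \<Rightarrow>\<^sub>0 'k) \<Rightarrow> (nat multiset \<Rightarrow>\<^sub>0 'k)" where
  "enveloping_act t p = lin_ext (\<lambda>w. foldr lie_act (letters w) p) t"

lemma foldr_lie_act_add: "foldr lie_act l (p + q) = foldr lie_act l p + foldr lie_act l q"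
  by (induction l) (auto simp: lie_act_add)

lemma foldr_lie_act_cst: "foldr lie_act l (cst c * p) = cst c * foldr lie_act l p"
  by (induction l) (auto simp: lie_act_cst)

lemma enveloping_act_add_left: "enveloping_act (s + t) p = enveloping_act s p + enveloping_act t p"
  by (simp add: enveloping_act_def lin_ext_add)

lemma enveloping_act_diff_left: "enveloping_act (s - t) p = enveloping_act s p - enveloping_act t p"
  by (simp add: enveloping_act_def lin_ext_diff)

lemma enveloping_act_add: "enveloping_act t (p + q) = enveloping_act t p + enveloping_act t q"
  by (simp add: enveloping_act_def foldr_lie_act_add lin_ext_def distrib_left sum.distrib)

lemma enveloping_act_cst: "enveloping_act t (cst c * p) = cst c * enveloping_act t p"
  unfolding enveloping_act_def foldr_lie_act_cst by (simp add: lin_ext_mult_left)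

lemma enveloping_act_mult: "enveloping_act (s * t) p = enveloping_act s (enveloping_act t p)"
proof (induction s rule: poly_mapping_add_induct)
  case (single v a)
  show ?case
  proof (induction t rule: poly_mapping_add_induct)
    case (single w b)
    show ?case
      by (simp add: enveloping_act_def mult_single plus_free_word_def foldr_lie_act_cst cst_cst_mult)
  qed (simp add: enveloping_act_add_left distrib_left enveloping_act_add)
qed (simp add: enveloping_act_add_left distrib_right)

lemma enveloping_act_free_gen: "enveloping_act (free_gen y) p = lie_act y p"
  by (simp add: enveloping_act_def free_gen_def)

lemma enveloping_act_cst_left: "enveloping_act (cst c) p = cst c * p"
  by (simp add: enveloping_act_def zero_free_word_def)

lemma enveloping_act_zero [simp]: "enveloping_act t 0 = 0"
  using enveloping_act_cst[of t 0 0] by simp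

text \<open>
  The elements of the free algebra that act as zero form a two-sided ideal, and the relations are among
  them; so the action descends to the enveloping algebra.
\<close>

theorem enveloping_ideal_acts_as_zero:
  assumes "t \<in> I"
  shows "enveloping_act t p = 0"
proof -
  let ?K = "{t. \<forall>p. enveloping_act t p = 0}"
  have "lie_act x (lie_act y p) - lie_act y (lie_act x p) - lie_act (bracket x y) p = 0" for x y p
    by (subst lie_act_commute) simp
  then have "enveloping_relations scale bracket \<subseteq> ?K"
    by (auto simp: enveloping_relations_def enveloping_act_diff_left enveloping_act_free_gen lie_act_add_left free_scalar_def
        enveloping_act_mult enveloping_act_cst_left lie_act_scale_left)
  then have "I \<subseteq> ?K"
    by (intro enveloping_ideal_least) (auto simp: enveloping_act_add_left enveloping_act_mult enveloping_act_def[of 0])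
  then show ?thesis using assms by blast
qed

section \<open>Principal symbols\<close>

definition lin_form :: "'g \<Rightarrow> (nat multiset \<Rightarrow>\<^sub>0 'k)" where
  "lin_form y = (\<Sum>k<n. cst (coord k y) * mon {#k#})"

text \<open>
  The homomorphism from the free algebra to the commutative polynomials. For an element \<open>t\<close> of degree at
  most \<open>d\<close> the terms of degree \<open>d\<close> in \<open>symbol t\<close> are the principal symbol of the image of \<open>t\<close> in the
  enveloping algebra; only these terms are invariant modulo the enveloping ideal.
\<close>

definition symbol :: "('k, 'g) free_alg \<Rightarrow> (nat multiset \<Rightarrow>\<^sub>0 'k)" where
  "symbol t = lin_ext (\<lambda>w. prod_list (map lin_form (letters w))) t"

lemma lin_form_add: "lin_form (x + y) = lin_form x + lin_form y"
  by (simp add: lin_form_def coord_add cst_add_mult sum.distrib)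

lemma lin_form_scale: "lin_form (scale c x) = cst c * lin_form x"
  by (simp add: lin_form_def coord_scale cst_cst_mult sum_distrib_left)

lemma lin_form_b: "i < n \<Longrightarrow> lin_form (b i) = mon {#i#}"
proof -
  assume "i < n"
  then have "lin_form (b i) = (\<Sum>k<n. if k = i then mon {#k#} else 0)"
    unfolding lin_form_def by (intro sum.cong) (auto simp: coord_b)
  then show ?thesis using \<open>i < n\<close> by simp
qed

lemma lin_form_deg_below: "lin_form y \<in> deg_below size (Suc 1)"
  unfolding lin_form_def by (intro deg_below_sum deg_below_cst deg_below_single) simp

lemma lin_form_mult_deg_below: "p \<in> deg_below size d \<Longrightarrow> lin_form y * p \<in> deg_below size (Suc d)"
  using deg_below_mult_left[OF _ lin_form_deg_below, of p d y] by simp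

lemma prod_lin_form_deg_below: "prod_list (map lin_form l) \<in> deg_below size (Suc (length l))"
proof (induction l)
  case Nil
  then show ?case by (simp add: deg_below_def)
qed (simp add: lin_form_mult_deg_below)

lemma symbol_mult: "symbol (s * t) = symbol s * symbol t"
  unfolding symbol_def by (rule lin_ext_mult) (simp add: plus_free_word_def)

lemma symbol_add: "symbol (s + t) = symbol s + symbol t"
  by (simp add: symbol_def lin_ext_add)

lemma symbol_diff: "symbol (s - t) = symbol s - symbol t"
  by (simp add: symbol_def lin_ext_diff)

lemma symbol_free_gen: "symbol (free_gen y) = lin_form y"
  by (simp add: symbol_def free_gen_def)

lemma symbol_cst: "symbol (cst c) = cst c"
  by (simp add: symbol_def zero_free_word_def)

lemma symbol_deg_below: "t \<in> deg_below len d \<Longrightarrow> symbol t \<in> deg_below size d"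
  unfolding symbol_def by (erule deg_below_lin_ext) (auto intro: deg_below_mono prod_lin_form_deg_below)

lemma mon_mult: "mon {#k#} * p = lin_ext (\<lambda>m. mon (add_mset k m)) p"
  by (induction p rule: poly_mapping_add_induct)
    (simp_all add: lin_ext_add distrib_left mult_single)

lemma lie_act_leading:
  assumes "p \<in> deg_below size d"
  shows "lie_act y p - lin_form y * p \<in> deg_below size d"
proof -
  have "lie_act y p - lin_form y * p
      = (\<Sum>k<n. cst (coord k y) * (lin_ext (rho k) p - lin_ext (\<lambda>m. mon (add_mset k m)) p))"
    by (simp add: lie_act_def lin_form_def sum_distrib_right right_diff_distrib sum_subtractf mult.assoc mon_mult)
  also have "\<dots> = (\<Sum>k<n. cst (coord k y) * lin_ext (\<lambda>m. rho k m - mon (add_mset k m)) p)"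
    by (simp add: lin_ext_fun_diff)
  also have "\<dots> \<in> deg_below size d"
    using assms by (intro deg_below_sum deg_below_cst deg_below_lin_ext[where s = size and d = d])
      (auto intro: deg_below_mono rho_leading)
  finally show ?thesis .
qed

text \<open>
  A word applied to the polynomial \<open>1\<close> gives back the product of its letters up to lower degree, so the
  action detects principal symbols.
\<close>

lemma foldr_lie_act_leading: "foldr lie_act l 1 - prod_list (map lin_form l) \<in> deg_below size (length l)"
proof (induction l)
  case (Cons y l)
  let ?p = "foldr lie_act l 1" and ?q = "prod_list (map lin_form l)"
  have "?p - ?q + ?q \<in> deg_below size (Suc (length l))"
    using Cons prod_lin_form_deg_below[of l] by (intro deg_below_add) (auto intro: deg_below_mono)
  then have "lie_act y ?p - lin_form y * ?p \<in> deg_below size (Suc (length l))"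
    by (intro lie_act_leading) simp
  moreover have "lin_form y * (?p - ?q) \<in> deg_below size (Suc (length l))"
    using Cons by (rule lin_form_mult_deg_below)
  ultimately have "(lie_act y ?p - lin_form y * ?p) + lin_form y * (?p - ?q) \<in> deg_below size (Suc (length l))"
    by (rule deg_below_add)
  then show ?case by (simp add: algebra_simps)
qed simp

text \<open>
  Principal symbols are well defined on the enveloping algebra: an element of the ideal sends \<open>1\<close> to zero,
  while the top degree part of the image of \<open>1\<close> is the principal symbol.
\<close>

lemma symbol_enveloping_ideal:
  assumes "t \<in> I" "t \<in> deg_below len (Suc d)"
  shows "symbol t \<in> deg_below size d"
proof -
  have "enveloping_act t 1 - symbol t = lin_ext (\<lambda>w. foldr lie_act (letters w) 1 - prod_list (map lin_form (letters w))) t"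
    by (simp add: enveloping_act_def symbol_def lin_ext_fun_diff)
  also have "\<dots> \<in> deg_below size d"
    using assms(2) by (rule deg_below_lin_ext) (auto intro: deg_below_mono foldr_lie_act_leading)
  finally have "- (enveloping_act t 1 - symbol t) \<in> deg_below size d" by (rule deg_below_uminus)
  then show ?thesis using enveloping_ideal_acts_as_zero[OF assms(1)] by simp
qed

section \<open>Straightening words\<close>

text \<open>
  The elements that are congruent, modulo the enveloping ideal, to one of degree below \<open>d\<close>.
\<close>

definition mod_lower :: "nat \<Rightarrow> ('k, 'g) free_alg set" where
  "mod_lower d = {t. \<exists>r\<in>deg_below len d. t - r \<in> I}"

lemma mod_lower_I: "t \<in> I \<Longrightarrow> t \<in> mod_lower d"
  unfolding mod_lower_def by (auto intro!: bexI[of _ 0])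

lemma mod_lower_deg_below: "t \<in> deg_below len d \<Longrightarrow> t \<in> mod_lower d"
  unfolding mod_lower_def by (auto intro!: bexI[of _ t])

lemma mod_lower_add:
  assumes "s \<in> mod_lower d" "t \<in> mod_lower d"
  shows "s + t \<in> mod_lower d"
proof -
  from assms obtain q r where "q \<in> deg_below len d" "s - q \<in> I" "r \<in> deg_below len d" "t - r \<in> I"
    unfolding mod_lower_def by blast
  then have "q + r \<in> deg_below len d" "s + t - (q + r) \<in> I"
    using I_add[of "s - q" "t - r"] by (auto simp: deg_below_add algebra_simps)
  then show ?thesis unfolding mod_lower_def by blast
qed

lemma mod_lower_mono: "t \<in> mod_lower d \<Longrightarrow> d \<le> e \<Longrightarrow> t \<in> mod_lower e"
  unfolding mod_lower_def using deg_below_mono by blast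

lemma mod_lower_cst:
  assumes "t \<in> mod_lower d"
  shows "cst c * t \<in> mod_lower d"
proof -
  from assms obtain r where "r \<in> deg_below len d" "t - r \<in> I"
    unfolding mod_lower_def by blast
  then have "cst c * r \<in> deg_below len d" "cst c * t - cst c * r \<in> I"
    using I_mult_left[of "t - r" "cst c"] by (simp_all add: deg_below_cst right_diff_distrib)
  then show ?thesis unfolding mod_lower_def by blast
qed

lemma mod_lower_sum: "(\<And>x. x \<in> S \<Longrightarrow> g x \<in> mod_lower d) \<Longrightarrow> sum g S \<in> mod_lower d"
  by (induction S rule: infinite_finite_induct) (auto intro: mod_lower_add mod_lower_I)

lemma mod_lower_lin_ext: "p \<in> deg_below s e \<Longrightarrow> (\<And>m. s m < e \<Longrightarrow> f m \<in> mod_lower d) \<Longrightarrow> lin_ext f p \<in> mod_lower d"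
  unfolding lin_ext_def by (intro mod_lower_sum mod_lower_cst) (auto simp: deg_below_def)

lemma free_gen_deg_below: "free_gen y \<in> deg_below len (Suc 1)"
  by (simp add: free_gen_def deg_below_single)

lemma free_gen_mult_deg_below: "t \<in> deg_below len d \<Longrightarrow> free_gen y * t \<in> deg_below len (Suc d)"
  using deg_below_mult_left[OF len_plus free_gen_deg_below, of t d y] by simp

lemma mod_lower_free_gen_mult:
  assumes "t \<in> mod_lower d"
  shows "free_gen y * t \<in> mod_lower (Suc d)"
proof -
  from assms obtain r where "r \<in> deg_below len d" "t - r \<in> I"
    unfolding mod_lower_def by blast
  then have "free_gen y * r \<in> deg_below len (Suc d)" "free_gen y * t - free_gen y * r \<in> I"
    using I_mult_left[of "t - r" "free_gen y"] by (simp_all add: free_gen_mult_deg_below right_diff_distrib)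
  then show ?thesis unfolding mod_lower_def by blast
qed

text \<open>
  Swapping two adjacent letters changes a word by the word with their bracket in place of the two letters,
  which is shorter.
\<close>

lemma word_insort:
  "word (b i # map b l) - word (map b (insort i l)) \<in> mod_lower (Suc (length l))"
proof (induction l)
  case Nil
  then show ?case by (simp add: mod_lower_I)
next
  case (Cons j l)
  show ?case
  proof (cases "i \<le> j")
    case True
    then show ?thesis by (simp add: mod_lower_I)
  next
    case False
    let ?w = "word (map b l)"
    have "word (b i # map b (j # l)) - word (map b (insort i (j # l)))
      = (free_gen (b i) * free_gen (b j) - free_gen (b j) * free_gen (b i)
          - free_gen (bracket (b i) (b j))) * ?w
        + word (bracket (b i) (b j) # map b l)
        + free_gen (b j) * (word (b i # map b l) - word (map b (insort i l)))"
      using False by (simp add: free_gen_mult_word mult.assoc left_diff_distrib right_diff_distrib)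
    also have "\<dots> \<in> mod_lower (Suc (length (j # l)))"
    proof (intro mod_lower_add)
      show "(free_gen (b i) * free_gen (b j) - free_gen (b j) * free_gen (b i)
          - free_gen (bracket (b i) (b j))) * ?w \<in> mod_lower (Suc (length (j # l)))"
        by (intro mod_lower_I I_mult_right I_relations)
      show "word (bracket (b i) (b j) # map b l) \<in> mod_lower (Suc (length (j # l)))"
        by (intro mod_lower_deg_below deg_below_single) simp
      show "free_gen (b j) * (word (b i # map b l) - word (map b (insort i l)))
          \<in> mod_lower (Suc (length (j # l)))"
        using mod_lower_free_gen_mult[OF Cons] by simp
    qed
    finally show ?thesis .
  qed
qed

text \<open>
  The sorted word in the basis vectors that corresponds to a monomial, i.e. the element of the
  Poincare-Birkhoff-Witt basis.
\<close>

definition std_word :: "nat multiset \<Rightarrow> ('k, 'g) free_alg" where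
  "std_word m = word (map b (sorted_list_of_multiset m))"

lemma std_word_add_mset:
  "free_gen (b i) * std_word m - std_word (add_mset i m) \<in> mod_lower (Suc (size m))"
proof -
  have "length (sorted_list_of_multiset m) = size m"
    by (metis mset_sorted_list_of_multiset size_mset)
  then show ?thesis
    using word_insort[of i "sorted_list_of_multiset m"]
    by (simp add: std_word_def free_gen_mult_word)
qed

lemma std_word_deg_below: "std_word m \<in> deg_below len (Suc (size m))"
proof -
  have "length (sorted_list_of_multiset m) = size m"
    by (metis mset_sorted_list_of_multiset size_mset)
  then show ?thesis by (simp add: std_word_def deg_below_single)
qed

lemma free_gen_expand: "free_gen y - (\<Sum>i<n. cst (coord i y) * free_gen (b i)) \<in> I"
proof -
  have "free_gen (\<Sum>i<k. scale (coord i y) (b i)) - (\<Sum>i<k. cst (coord i y) * free_gen (b i)) \<in> I" for k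
  proof (induction k)
    case 0
    show ?case using I_relations(2)[of 0 0] by simp
  next
    case (Suc k)
    let ?s = "\<Sum>i<k. scale (coord i y) (b i)" and ?t = "scale (coord k y) (b k)"
    have "(free_gen ?s - (\<Sum>i<k. cst (coord i y) * free_gen (b i)))
        + (free_gen (?s + ?t) - free_gen ?s - free_gen ?t)
        + (free_gen ?t - cst (coord k y) * free_gen (b k)) \<in> I"
      using Suc by (intro I_add I_relations)
    then show ?case by (simp add: algebra_simps)
  qed
  from this[of n] show ?thesis by (simp flip: expand)
qed

lemma std_lin_form_mult:
  assumes "p \<in> deg_below size (Suc d)"
  shows "free_gen y * lin_ext std_word p - lin_ext std_word (lin_form y * p) \<in> mod_lower (Suc d)"
proof -
  let ?s = "\<Sum>i<n. cst (coord i y) * free_gen (b i)"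
  let ?f = "\<lambda>i m. free_gen (b i) * std_word m - std_word (add_mset i m)"
  have "free_gen y * lin_ext std_word p - lin_ext std_word (lin_form y * p)
      = (free_gen y - ?s) * lin_ext std_word p
        + (\<Sum>i<n. cst (coord i y) * (free_gen (b i) * lin_ext std_word p - lin_ext std_word (mon {#i#} * p)))"
    by (simp add: left_diff_distrib right_diff_distrib sum_distrib_right lin_form_def lin_ext_sum lin_ext_cst
        mult.assoc sum_subtractf)
  also have "\<dots> = (free_gen y - ?s) * lin_ext std_word p + (\<Sum>i<n. cst (coord i y) * lin_ext (?f i) p)"
    by (simp add: lin_ext_fun_diff lin_ext_mult_left mon_mult lin_ext_lin_ext)
  also have "\<dots> \<in> mod_lower (Suc d)"
  proof (intro mod_lower_add mod_lower_sum mod_lower_cst)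
    show "(free_gen y - ?s) * lin_ext std_word p \<in> mod_lower (Suc d)"
      by (intro mod_lower_I I_mult_right free_gen_expand)
    show "lin_ext (?f i) p \<in> mod_lower (Suc d)" for i
      using assms by (rule mod_lower_lin_ext) (rule mod_lower_mono[OF std_word_add_mset], simp)
  qed
  finally show ?thesis .
qed

text \<open>
  Modulo the enveloping ideal and shorter words, a word is the combination of sorted words that its
  symbol prescribes.
\<close>

lemma word_std: "word l - lin_ext std_word (prod_list (map lin_form l)) \<in> mod_lower (length l)"
proof (induction l)
  case Nil
  have "lin_ext std_word (1 :: nat multiset \<Rightarrow>\<^sub>0 'k) = word []"
    using lin_ext_single[of std_word "{#}" 1] by (simp add: std_word_def)
  then show ?case by (simp add: mod_lower_I)
next
  case (Cons y l)
  let ?p = "prod_list (map lin_form l)"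
  have "word (y # l) - lin_ext std_word (lin_form y * ?p) = free_gen y * (word l - lin_ext std_word ?p)
      + (free_gen y * lin_ext std_word ?p - lin_ext std_word (lin_form y * ?p))"
    by (simp add: right_diff_distrib free_gen_mult_word)
  also have "\<dots> \<in> mod_lower (Suc (length l))"
    by (intro mod_lower_add mod_lower_free_gen_mult std_lin_form_mult prod_lin_form_deg_below Cons)
  finally show ?case by simp
qed

text \<open>
  The converse of \<open>symbol_enveloping_ideal\<close>: replacing every word by sorted words shows that an element is
  determined by its symbol up to lower degree.
\<close>

lemma mod_lower_if_symbol_deg_below:
  assumes "t \<in> deg_below len (Suc d)" "symbol t \<in> deg_below size d"
  shows "t \<in> mod_lower d"
proof -
  have "t - lin_ext std_word (symbol t)
      = lin_ext (\<lambda>w. word (letters w) - lin_ext std_word (prod_list (map lin_form (letters w)))) t"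
    by (simp add: lin_ext_fun_diff symbol_def lin_ext_lin_ext lin_ext_single_id)
  also have "\<dots> \<in> mod_lower d"
    using assms(1) by (rule mod_lower_lin_ext) (rule mod_lower_mono[OF word_std], simp)
  finally have "t - lin_ext std_word (symbol t) \<in> mod_lower d" .
  moreover have "lin_ext std_word (symbol t) \<in> mod_lower d"
    using assms(2) by (intro mod_lower_deg_below) (erule deg_below_lin_ext, auto intro: deg_below_mono std_word_deg_below)
  ultimately have "t - lin_ext std_word (symbol t) + lin_ext std_word (symbol t) \<in> mod_lower d"
    by (rule mod_lower_add)
  then show ?thesis by simp
qed

end

section \<open>The two-sided ideal inside a left ideal\<close>

context lie_algebra_basis
begin

text \<open>
  The commutator with \<open>y\<close> raises the degree in the free algebra, although it does not in the enveloping
  algebra. It is therefore replaced by the congruent derivation that applies \<open>ad y\<close> to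
  one letter of a word at a time and preserves the length.
\<close>

primrec free_der_word :: "'g \<Rightarrow> 'g list \<Rightarrow> ('k, 'g) free_alg" where
  "free_der_word y [] = 0"
| "free_der_word y (z # l) = word (bracket y z # l) + free_gen z * free_der_word y l"

definition free_der :: "'g \<Rightarrow> ('k, 'g) free_alg \<Rightarrow> ('k, 'g) free_alg" where
  "free_der y t = lin_ext (\<lambda>w. free_der_word y (letters w)) t"

lemma free_der_deg_below: "t \<in> deg_below len d \<Longrightarrow> free_der y t \<in> deg_below len d"
proof -
  have "free_der_word y l \<in> deg_below len (Suc (length l))" for l
    by (induction l) (simp_all add: deg_below_add deg_below_single free_gen_mult_deg_below)
  then show "t \<in> deg_below len d \<Longrightarrow> free_der y t \<in> deg_below len d"
    unfolding free_der_def by (erule_tac deg_below_lin_ext) (rule deg_below_mono, auto)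
qed

lemma commutator_free_der: "free_gen y * t - t * free_gen y - free_der y t \<in> I"
proof -
  have word: "free_gen y * word l - word l * free_gen y - free_der_word y l \<in> I" for l
  proof (induction l)
    case Nil
    then show ?case by (simp add: word_Nil)
  next
    case (Cons z l)
    have "free_gen y * word (z # l) - word (z # l) * free_gen y - free_der_word y (z # l)
      = (free_gen y * free_gen z - free_gen z * free_gen y - free_gen (bracket y z)) * word l
        + free_gen z * (free_gen y * word l - word l * free_gen y - free_der_word y l)"
      by (simp add: left_diff_distrib right_diff_distrib mult.assoc flip: free_gen_mult_word)
    also have "\<dots> \<in> I"
      by (intro I_add I_mult_right I_mult_left I_relations Cons)
    finally show ?case .
  qed
  have "free_gen y * t - t * free_gen y - free_der y t
      = free_gen y * lin_ext (\<lambda>w. word (letters w)) t - lin_ext (\<lambda>w. word (letters w)) t * free_gen y - free_der y t"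
    by (simp add: lin_ext_single_id)
  also have "\<dots> = lin_ext (\<lambda>w. free_gen y * word (letters w) - word (letters w) * free_gen y
      - free_der_word y (letters w)) t"
    by (simp only: lin_ext_mult_left lin_ext_mult_right lin_ext_fun_diff free_der_def)
  also have "\<dots> \<in> I"
    unfolding lin_ext_def by (intro I_sum I_mult_left word)
  finally show ?thesis .
qed

text \<open>
  The derivation of the polynomial ring that extends \<open>ad y\<close> on linear forms.
\<close>

definition poly_der_mon :: "'g \<Rightarrow> nat multiset \<Rightarrow> (nat multiset \<Rightarrow>\<^sub>0 'k)" where
  "poly_der_mon y m = (\<Sum>i\<in>#m. mon (m - {#i#}) * lin_form (bracket y (b i)))"

definition poly_der :: "'g \<Rightarrow> (nat multiset \<Rightarrow>\<^sub>0 'k) \<Rightarrow> (nat multiset \<Rightarrow>\<^sub>0 'k)" where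
  "poly_der y p = lin_ext (poly_der_mon y) p"

lemma poly_der_mon_add_mset:
  "poly_der_mon y (add_mset k m) = lin_form (bracket y (b k)) * mon m + mon {#k#} * poly_der_mon y m"
proof -
  have "(\<Sum>i\<in>#m. mon (add_mset k m - {#i#}) * lin_form (bracket y (b i)))
      = (\<Sum>i\<in>#m. mon {#k#} * (mon (m - {#i#}) * lin_form (bracket y (b i))))"
    by (intro arg_cong[of _ _ sum_mset] image_mset_cong) (simp add: mult_single flip: mult.assoc)
  then show ?thesis
    by (simp add: poly_der_mon_def sum_mset_distrib_left mult.commute)
qed

lemma poly_der_var_mult: "poly_der y (mon {#k#} * p) = lin_form (bracket y (b k)) * p + mon {#k#} * poly_der y p"
proof (induction p rule: poly_mapping_add_induct)
  case (single m c)
  have "mon {#k#} * Poly_Mapping.single m c = cst c * mon (add_mset k m)"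
    by (simp add: mult_single)
  then have "poly_der y (mon {#k#} * Poly_Mapping.single m c)
      = cst c * (lin_form (bracket y (b k)) * mon m + mon {#k#} * poly_der_mon y m)"
    by (simp only: poly_der_def lin_ext_cst lin_ext_single poly_der_mon_add_mset) simp
  also have "\<dots> = lin_form (bracket y (b k)) * (cst c * mon m) + mon {#k#} * (cst c * poly_der_mon y m)"
    by (simp only: distrib_left mult.left_commute)
  finally show ?case
    by (simp only: poly_der_def lin_ext_single cst_mult_single)
next
  case (add p q)
  then show ?case by (simp add: poly_der_def distrib_left lin_ext_add)
qed

text \<open>
  The product rule for multiplication by a linear form. It carries the induction along a word, whose image
  under \<open>symbol\<close> is a product of linear forms.
\<close>

lemma poly_der_lin_form_mult: "poly_der y (lin_form z * p) = lin_form (bracket y z) * p + lin_form z * poly_der y p"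
proof (rule eq_if_eq_on_basis[where y = z and f = "\<lambda>z. poly_der y (lin_form z * p)"
      and h = "\<lambda>z. lin_form (bracket y z) * p + lin_form z * poly_der y p"])
  show "poly_der y (lin_form (b i) * p) = lin_form (bracket y (b i)) * p + lin_form (b i) * poly_der y p" if "i < n" for i
    using that by (simp add: lin_form_b poly_der_var_mult)
qed (simp_all add: lin_form_add lin_form_scale bracket_add_right bracket_scale_right distrib_left
    distrib_right lin_ext_add lin_ext_cst poly_der_def mult.assoc)

lemma symbol_free_der: "symbol (free_der y t) = poly_der y (symbol t)"
proof -
  have symbol_word: "symbol (word l) = prod_list (map lin_form l)" for l
    by (simp add: symbol_def)
  have word: "symbol (free_der_word y l) = poly_der y (prod_list (map lin_form l))" for l
  proof (induction l)
    case Nil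
    have "poly_der y 1 = poly_der_mon y {#}"
      using lin_ext_single[of "poly_der_mon y" 0 1] by (simp add: poly_der_def)
    then show ?case by (simp add: symbol_def poly_der_mon_def)
  next
    case (Cons z l)
    then show ?case
      by (simp add: symbol_add symbol_mult symbol_free_gen symbol_word poly_der_lin_form_mult)
  qed
  have "symbol (free_der y t) = lin_ext (\<lambda>w. symbol (free_der_word y (letters w))) t"
    unfolding free_der_def symbol_def by (rule lin_ext_lin_ext)
  also have "\<dots> = poly_der y (symbol t)"
    by (simp only: word) (simp only: symbol_def poly_der_def lin_ext_lin_ext)
  finally show ?thesis .
qed

lemma lookup_mon_mult_lin_form_nonzero:
  assumes "Poly_Mapping.lookup (mon q * lin_form z) M \<noteq> 0"
  shows "\<exists>j. M = add_mset j q"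
proof (rule ccontr)
  assume *: "\<nexists>j. M = add_mset j q"
  have "mon q * lin_form z = (\<Sum>j<n. cst (coord j z) * mon (add_mset j q))"
    by (simp add: lin_form_def sum_distrib_left mult.left_commute mult_single)
  then have "Poly_Mapping.lookup (mon q * lin_form z) M = 0"
    using * by (auto simp: lookup_sum lookup_single when_def intro!: sum.neutral)
  then show False using assms by simp
qed

lemma lookup_sum_mset:
  "Poly_Mapping.lookup (\<Sum>i\<in>#m. f i) M = (\<Sum>i\<in>#m. Poly_Mapping.lookup (f i) M)"
  by (induction m) (simp_all add: lookup_add)

text \<open>
  If \<open>D\<close> sends variable \<open>0\<close> to variable \<open>1\<close>, then in \<open>D p\<close> the monomial obtained from \<open>m\<close> by replacing one
  variable \<open>0\<close> by \<open>1\<close> comes from \<open>m\<close> alone: it contains \<open>0\<close> with a smaller exponent than every monomial of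
  \<open>p\<close> of the same degree, so a variable \<open>0\<close> must have been differentiated, and \<open>D\<close> preserves degrees. The
  factor \<open>count m 0\<close> is the exponent that comes down in the derivative.
\<close>

lemma lookup_poly_der:
  assumes n: "1 < n" and y: "bracket y (b 0) = b 1" and m: "0 \<in># m"
    and p: "\<And>m'. m' \<in> Poly_Mapping.keys p \<Longrightarrow> size m' = size m \<Longrightarrow> count m 0 \<le> count m' 0"
  shows "Poly_Mapping.lookup (poly_der y p) (add_mset 1 (m - {#0#}))
    = Poly_Mapping.lookup p m * of_nat (count m 0)"
proof -
  let ?M = "add_mset 1 (m - {#0#})"
  have coeff: "Poly_Mapping.lookup (poly_der_mon y m') ?M = (if m' = m then of_nat (count m 0) else 0)"
    if m': "m' \<in> Poly_Mapping.keys p" for m'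
  proof -
    have "Poly_Mapping.lookup (mon (m' - {#i#}) * lin_form (bracket y (b i))) ?M
        = (if i = 0 then if m' = m then 1 else 0 else 0)" if i: "i \<in># m'" for i
    proof (cases "i = 0")
      case True
      then have "mon (m' - {#i#}) * lin_form (bracket y (b i)) = mon (add_mset 1 (m' - {#0#}))"
        using n y by (simp add: lin_form_b mult_single)
      moreover have "add_mset 1 (m' - {#0#}) = ?M \<longleftrightarrow> m' = m"
        using True i m by (metis add_mset_add_single add_right_cancel insert_DiffM)
      ultimately show ?thesis using True by (simp add: lookup_single when_def)
    next
      case False
      have "Poly_Mapping.lookup (mon (m' - {#i#}) * lin_form (bracket y (b i))) ?M = 0"
      proof (rule ccontr)
        assume "Poly_Mapping.lookup (mon (m' - {#i#}) * lin_form (bracket y (b i))) ?M \<noteq> 0"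
        then obtain j where j: "?M = add_mset j (m' - {#i#})"
          using lookup_mon_mult_lin_form_nonzero by blast
        have "size ?M = size m" using m by (metis insert_DiffM size_add_mset)
        moreover have "size ?M = size m'" unfolding j using i by (metis insert_DiffM size_add_mset)
        ultimately have "count m 0 \<le> count m' 0" using p[OF m'] by simp
        also have "\<dots> \<le> count ?M 0" unfolding j using False by simp
        also have "\<dots> < count m 0" using m by (simp add: count_greater_zero_iff)
        finally show False by simp
      qed
      then show ?thesis using False by simp
    qed
    then have "Poly_Mapping.lookup (poly_der_mon y m') ?M
        = (\<Sum>i\<in>#m'. if i = 0 then if m' = m then 1 else 0 else 0)"
      unfolding poly_der_mon_def lookup_sum_mset
      by (intro arg_cong[of _ _ sum_mset] image_mset_cong)
    then show ?thesis by (simp add: sum_mset_delta)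
  qed
  have "Poly_Mapping.lookup (poly_der y p) ?M
      = (\<Sum>m'\<in>Poly_Mapping.keys p. Poly_Mapping.lookup p m' * Poly_Mapping.lookup (poly_der_mon y m') ?M)"
    by (simp add: poly_der_def lin_ext_def lookup_sum)
  also have "\<dots> = (\<Sum>m'\<in>Poly_Mapping.keys p. if m' = m then Poly_Mapping.lookup p m * of_nat (count m 0) else 0)"
    using coeff by (intro sum.cong) auto
  also have "\<dots> = Poly_Mapping.lookup p m * of_nat (count m 0)"
    by (simp add: in_keys_iff)
  finally show ?thesis .
qed

lemma deg_below_of_mult_var:
  assumes "p * mon {#k#} \<in> deg_below size (Suc d)"
  shows "p \<in> deg_below size d"
proof -
  have "Poly_Mapping.lookup (p * mon {#k#}) (add_mset k m) = Poly_Mapping.lookup p m" for m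
    by (induction p rule: poly_mapping_add_induct)
      (simp_all add: mult_single distrib_right lookup_add lookup_single when_def)
  then show ?thesis using assms unfolding deg_below_iff_lookup by (metis Suc_le_mono size_add_mset)
qed

lemma var_in_monomials_of_mult_var:
  assumes "Poly_Mapping.lookup (p * mon {#k#}) m \<noteq> 0"
  shows "k \<in># m"
  using keys_mult[of p "mon {#k#}"] assms by (auto simp: in_keys_iff)

lemma affine_deg_below: "free_gen y + cst c \<in> deg_below len (Suc 1)"
  by (intro deg_below_add free_gen_deg_below deg_below_single) simp

lemma symbol_mult_affine:
  assumes "i < n"
  shows "symbol (v * (free_gen (b i) + cst c)) = symbol v * mon {#i#} + cst c * symbol v"
  using assms by (simp only: symbol_mult symbol_add symbol_free_gen symbol_cst lin_form_b distrib_left) (simp add: mult.commute)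

text \<open>
  If \<open>a\<close> of degree at most \<open>d\<close> is a multiple \<open>v x\<close> in the enveloping algebra, then \<open>v\<close> can be chosen of degree below
  \<open>d\<close>. Otherwise the principal symbol of \<open>v x\<close>, which is that of \<open>v\<close> times the variable \<open>0\<close>, would have
  degree exceeding that of \<open>a\<close>; so the principal symbol of \<open>v\<close> vanishes and \<open>v\<close> is congruent to an element
  of lower degree.
\<close>

lemma lower_degree_quotient:
  assumes n: "0 < n" and a: "a \<in> deg_below len (Suc d)"
    and v: "v \<in> deg_below len e" "a - v * (free_gen (b 0) + cst c) \<in> I"
  shows "\<exists>v'\<in>deg_below len d. a - v' * (free_gen (b 0) + cst c) \<in> I"
  using v
proof (induction e arbitrary: v)
  case 0
  then show ?case by (intro bexI[of _ v]) auto
next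
  case (Suc e)
  let ?x = "free_gen (b 0) + cst c"
  show ?case
  proof (cases "Suc e \<le> d")
    case True
    then show ?thesis using Suc by (intro bexI[of _ v]) (auto intro: deg_below_mono)
  next
    case False
    then have de: "d \<le> e" by simp
    have "v * ?x \<in> deg_below len (Suc e + 1)"
      using Suc.prems(1) affine_deg_below by (rule deg_below_mult_right[OF len_plus])
    then have "a - v * ?x \<in> deg_below len (Suc (Suc e))"
      using a de by (intro deg_below_diff) (auto intro: deg_below_mono)
    with Suc.prems(2) have "symbol (a - v * ?x) \<in> deg_below size (Suc e)"
      by (rule symbol_enveloping_ideal)
    moreover have "symbol a \<in> deg_below size (Suc e)"
      using a de by (intro symbol_deg_below) (auto intro: deg_below_mono)
    moreover have "cst c * symbol v \<in> deg_below size (Suc e)"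
      using Suc.prems(1) by (intro deg_below_cst symbol_deg_below)
    ultimately have "symbol a - symbol (a - v * ?x) - cst c * symbol v \<in> deg_below size (Suc e)"
      by (intro deg_below_diff)
    then have "symbol v * mon {#0#} \<in> deg_below size (Suc e)"
      by (simp add: symbol_diff symbol_mult_affine[OF n])
    then have "symbol v \<in> deg_below size e" by (rule deg_below_of_mult_var)
    with Suc.prems(1) have "v \<in> mod_lower e" by (rule mod_lower_if_symbol_deg_below)
    then obtain v' where v': "v' \<in> deg_below len e" "v - v' \<in> I"
      unfolding mod_lower_def by blast
    have "a - v' * ?x = (a - v * ?x) + (v - v') * ?x"
      by (simp add: left_diff_distrib)
    also have "\<dots> \<in> I"
      using Suc.prems(2) v' by (intro I_add I_mult_right)
    finally show ?thesis using v' by (intro Suc.IH)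
  qed
qed

text \<open>
  The annihilator of \<open>U/Ux\<close> is zero if \<open>x\<close> is the first basis vector plus a scalar and some \<open>ad y\<close> sends the
  first basis vector to the second one. This is the argument with the least exponent of the first variable
  that is described at the beginning.
\<close>

theorem cyclic_annihilator_trivial:
  assumes n: "1 < n" and y: "bracket y (b 0) = b 1"
    and char: "\<And>k. 0 < k \<Longrightarrow> of_nat k \<noteq> (0::'k)"
    and a: "\<And>u. \<exists>v. a * u - v * (free_gen (b 0) + cst c) \<in> I"
  shows "a \<in> I"
proof -
  let ?x = "free_gen (b 0) + cst c"
  \<comment> \<open>The preimage of the annihilator in the free algebra.\<close>
  define Z where "Z = {a. \<forall>u. \<exists>v. a * u - v * ?x \<in> I}"
  have Z_add_I: "s + t \<in> Z" if s: "s \<in> Z" and t: "t \<in> I" for s t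
    unfolding Z_def mem_Collect_eq
  proof
    fix u
    obtain v where "s * u - v * ?x \<in> I" using s unfolding Z_def by blast
    moreover have "t * u \<in> I" using t by (rule I_mult_right)
    ultimately have "(s * u - v * ?x) + t * u \<in> I" by (rule I_add)
    then show "\<exists>v. (s + t) * u - v * ?x \<in> I" by (auto simp: algebra_simps)
  qed
  have Z_comm: "free_gen z * s - s * free_gen z \<in> Z" if s: "s \<in> Z" for s z
    unfolding Z_def mem_Collect_eq
  proof
    fix u
    obtain v where v: "s * u - v * ?x \<in> I" using s unfolding Z_def by blast
    obtain v' where v': "s * (free_gen z * u) - v' * ?x \<in> I" using s unfolding Z_def by blast
    have "free_gen z * (s * u - v * ?x) - (s * (free_gen z * u) - v' * ?x) \<in> I"
      by (rule I_diff[OF I_mult_left[OF v] v'])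
    moreover have "free_gen z * (s * u - v * ?x) - (s * (free_gen z * u) - v' * ?x)
        = (free_gen z * s - s * free_gen z) * u - (free_gen z * v - v') * ?x"
      by (simp only: left_diff_distrib right_diff_distrib mult.assoc) simp
    ultimately show "\<exists>v. (free_gen z * s - s * free_gen z) * u - v * ?x \<in> I"
      by auto
  qed
  have Z_der: "free_der z s \<in> Z" if "s \<in> Z" for s z
  proof -
    have "free_gen z * s - s * free_gen z + - (free_gen z * s - s * free_gen z - free_der z s) \<in> Z"
      using that by (intro Z_add_I Z_comm I_uminus commutator_free_der)
    then show ?thesis by simp
  qed
  \<comment> \<open>Monomials that occur in principal symbols of elements of the annihilator.\<close>
  define leading where "leading m \<longleftrightarrow> (\<exists>s\<in>Z. s \<in> deg_below len (Suc (size m)) \<and> m \<in> Poly_Mapping.keys (symbol s))" for m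
  have no_leading: "\<not> leading m" for m
  proof
    assume "leading m"
    then obtain m where m: "leading m" and least: "\<And>m'. leading m' \<Longrightarrow> count m 0 \<le> count m' 0"
      using ex_has_least_nat[of leading m "\<lambda>m. count m 0"] by blast
    obtain s where s: "s \<in> Z" "s \<in> deg_below len (Suc (size m))" "m \<in> Poly_Mapping.keys (symbol s)"
      using m unfolding leading_def by blast
    show False
    proof (cases "0 \<in># m")
      case True
      \<comment> \<open>The derivation produces a leading monomial with a smaller exponent of variable \<open>0\<close>.\<close>
      let ?M = "add_mset 1 (m - {#0#})"
      have M: "size ?M = size m" using True by (metis insert_DiffM size_add_mset)
      have "Poly_Mapping.lookup (poly_der y (symbol s)) ?M = Poly_Mapping.lookup (symbol s) m * of_nat (count m 0)"
        using n y True
      proof (rule lookup_poly_der)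
        fix m' assume "m' \<in> Poly_Mapping.keys (symbol s)" "size m' = size m"
        then have "leading m'" using s unfolding leading_def by auto
        then show "count m 0 \<le> count m' 0" by (rule least)
      qed
      then have "?M \<in> Poly_Mapping.keys (symbol (free_der y s))"
        using True s(3) char[of "count m 0"] by (simp add: symbol_free_der in_keys_iff)
      then have "leading ?M"
        unfolding leading_def M using s by (intro bexI[of _ "free_der y s"] conjI free_der_deg_below Z_der)
      then have "count m 0 \<le> count ?M 0" by (rule least)
      moreover have "count ?M 0 < count m 0" using True by (simp add: count_greater_zero_iff)
      ultimately show False by linarith
    next
      case False
      \<comment> \<open>An element of \<open>Ux\<close> cannot have a leading monomial without the variable \<open>0\<close>.\<close>
      obtain v where "s * 1 - v * ?x \<in> I" using s(1) unfolding Z_def by blast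
      moreover obtain e where "v \<in> deg_below len e" using ex_deg_below by blast
      ultimately obtain v where v: "v \<in> deg_below len (size m)" "s - v * ?x \<in> I"
        using lower_degree_quotient[of s "size m" v e c] n s(2) by auto
      have "v * ?x \<in> deg_below len (Suc (size m))"
        using deg_below_mult_right[OF len_plus v(1) affine_deg_below] by simp
      have "symbol (s - v * ?x) \<in> deg_below size (size m)"
        using v s(2) \<open>v * ?x \<in> deg_below len (Suc (size m))\<close>
        by (intro symbol_enveloping_ideal deg_below_diff)
      then have "Poly_Mapping.lookup (symbol (s - v * ?x)) m = 0" by (simp add: deg_below_iff_lookup)
      moreover have "Poly_Mapping.lookup (symbol v) m = 0"
        using symbol_deg_below[OF v(1)] by (simp add: deg_below_iff_lookup)
      moreover have "Poly_Mapping.lookup (symbol v * mon {#0#}) m = 0"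
        using False var_in_monomials_of_mult_var by blast
      ultimately have "Poly_Mapping.lookup (symbol s) m = 0"
        using n by (simp add: symbol_diff symbol_mult_affine lookup_minus lookup_add)
      then show False using s(3) by (simp add: in_keys_iff)
    qed
  qed
  \<comment> \<open>Without leading monomials, the degree of an element of the annihilator can be lowered until it is zero.\<close>
  have "s \<in> I" if "s \<in> Z" "s \<in> deg_below len d" for s d
    using that
  proof (induction d arbitrary: s)
    case 0
    then show ?case by simp
  next
    case (Suc d)
    have "m \<notin> Poly_Mapping.keys (symbol s)" if "size m = d" for m
      using no_leading[of m] Suc.prems that unfolding leading_def by blast
    then have "symbol s \<in> deg_below size d"
      using symbol_deg_below[OF Suc.prems(2)] unfolding deg_below_def by (auto simp: less_Suc_eq)
    with Suc.prems(2) have "s \<in> mod_lower d" by (rule mod_lower_if_symbol_deg_below)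
    then obtain r where r: "r \<in> deg_below len d" "s - r \<in> I" unfolding mod_lower_def by blast
    have "s + - (s - r) \<in> Z" using Suc.prems(1) r by (intro Z_add_I I_uminus)
    then have "r \<in> I" using r by (intro Suc.IH) simp
    then have "(s - r) + r \<in> I" using r by (intro I_add)
    then show ?case by simp
  qed
  moreover have "a \<in> Z" using a unfolding Z_def by blast
  moreover obtain d where "a \<in> deg_below len d" using ex_deg_below by blast
  ultimately show ?thesis by blast
qed

text \<open>
  The Lie algebra embeds into its enveloping algebra and meets the scalars in zero there: the principal
  symbol of \<open>y + c\<close> in degree one is the linear form of \<open>y\<close>.
\<close>

theorem zero_if_affine_in_enveloping_ideal:
  assumes "free_gen y + cst c \<in> I"
  shows "y = 0"
proof -
  from assms affine_deg_below have "symbol (free_gen y + cst c) \<in> deg_below size 1"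
    by (rule symbol_enveloping_ideal)
  then have *: "Poly_Mapping.lookup (lin_form y + cst c) {#i#} = 0" for i
    by (simp add: deg_below_iff_lookup symbol_add symbol_free_gen symbol_cst)
  have "coord i y = 0" if "i < n" for i
  proof -
    have "Poly_Mapping.lookup (lin_form y) {#i#} = (\<Sum>k<n. if k = i then coord k y else 0)"
      unfolding lin_form_def lookup_sum by (intro sum.cong) (auto simp: lookup_single when_def)
    then show ?thesis using *[of i] that by (simp add: lookup_add lookup_single when_def)
  qed
  then show ?thesis using expand[of y] by simp
qed

end

section \<open>Cyclic modules and points of the space of affine elements\<close>

lemma enveloping_coset_eq_iff:
  fixes s t :: "('k::field, 'g::ab_group_add) free_alg"
  shows "enveloping_ideal scale bracket +>\<^bsub>free_ring\<^esub> s = enveloping_ideal scale bracket +>\<^bsub>free_ring\<^esub> t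
    \<longleftrightarrow> s - t \<in> enveloping_ideal scale bracket"
proof -
  interpret ring "free_ring :: ('k, 'g) free_alg ring" by (rule ring_free_ring)
  have "\<ominus>\<^bsub>free_ring\<^esub> t = - t"
    by (rule minus_equality) (simp_all add: ring_of_type_algebra_def)
  then have "s \<ominus>\<^bsub>free_ring\<^esub> t = s - t"
    by (simp add: a_minus_def) (simp add: ring_of_type_algebra_def)
  then show ?thesis
    using quotient_eq_iff_same_a_r_cos[OF enveloping_ideal_ideal, of s t scale bracket]
    by (simp add: ring_of_type_algebra_def)
qed

lemma enveloping_carrier:
  "carrier (enveloping_algebra scale bracket)
    = range (\<lambda>t. enveloping_ideal scale bracket +>\<^bsub>free_ring\<^esub> t)"
  by (auto simp: enveloping_algebra_def Let_def FactRing_def A_RCOSETS_def' ring_of_type_algebra_def)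

lemma enveloping_zero:
  fixes scale :: "'k::field \<Rightarrow> 'g::ab_group_add \<Rightarrow> 'g"
  shows "\<zero>\<^bsub>enveloping_algebra scale bracket\<^esub> = enveloping_ideal scale bracket +>\<^bsub>free_ring\<^esub> 0"
proof -
  interpret ideal "enveloping_ideal scale bracket" "free_ring :: ('k, 'g) free_alg ring"
    by (rule enveloping_ideal_ideal)
  have "enveloping_ideal scale bracket +>\<^bsub>free_ring\<^esub> \<zero>\<^bsub>free_ring\<^esub> = enveloping_ideal scale bracket"
    using a_subset by (rule a_coset_add_zero)
  then show ?thesis
    by (simp add: enveloping_algebra_def Let_def FactRing_def ring_of_type_algebra_def)
qed

text \<open>
  The element \<open>x + c\<close> of \<open>U\<^sub>1\<close>; all points of \<open>U\<^sub>1\<close> have this form.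
\<close>

definition affine_point ::
  "('k::field \<Rightarrow> 'g::ab_group_add \<Rightarrow> 'g) \<Rightarrow> ('g \<Rightarrow> 'g \<Rightarrow> 'g) \<Rightarrow> 'g \<Rightarrow> 'k \<Rightarrow> ('k, 'g) free_alg set" where
  "affine_point scale bracket x c
    = enveloping_ideal scale bracket +>\<^bsub>free_ring\<^esub> (free_gen x + cst c)"

lemma affine_point_eq:
  "enveloping_gen scale bracket x \<oplus>\<^bsub>enveloping_algebra scale bracket\<^esub>
    (c \<odot>\<^bsub>enveloping_algebra scale bracket\<^esub> \<one>\<^bsub>enveloping_algebra scale bracket\<^esub>)
    = affine_point scale bracket x c"
  by (simp add: affine_point_def enveloping_gen_def enveloping_algebra_sel free_scalar_def)

lemma carrier_U1:
  "carrier (enveloping_U1 scale bracket) = {affine_point scale bracket x c | x c. True}"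
  by (simp add: enveloping_U1_def Let_def affine_point_eq)

text \<open>
  Applying an annihilating \<open>r\<close> to the class of \<open>u\<close> shows \<open>r u \<in> R x\<close>.
\<close>

lemma cyclic_quotient_annihilator:
  assumes "ring R" "x \<in> carrier R" "r \<in> annihilator R (cyclic_quotient R x)" "u \<in> carrier R"
  shows "\<exists>v\<in>carrier R. r \<otimes>\<^bsub>R\<^esub> u = v \<otimes>\<^bsub>R\<^esub> x"
proof -
  interpret R: ring R by fact
  let ?L = "PIdl\<^bsub>R\<^esub> x"
  have r: "r \<in> carrier R" using assms(3) by (simp add: annihilator_def)
  have zero: "\<zero>\<^bsub>R\<^esub> \<in> ?L"
    using assms(2) by (auto simp: cgenideal_def intro!: exI[of _ "\<zero>\<^bsub>R\<^esub>"])
  have self: "w \<in> ?L +>\<^bsub>R\<^esub> w" if "w \<in> carrier R" for w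
    using zero that by (auto simp: a_r_coset_def' intro!: bexI[of _ "\<zero>\<^bsub>R\<^esub>"])
  have "?L +>\<^bsub>R\<^esub> u \<in> carrier (cyclic_quotient R x)"
    using assms(4) by (auto simp: left_quotient_def A_RCOSETS_def')
  then have "(\<Union>w\<in>?L +>\<^bsub>R\<^esub> u. ?L +>\<^bsub>R\<^esub> (r \<otimes>\<^bsub>R\<^esub> w)) = ?L"
    using assms(3) by (auto simp: annihilator_def left_quotient_def)
  moreover have "u \<in> ?L +>\<^bsub>R\<^esub> u" using assms(4) by (rule self)
  moreover have "r \<otimes>\<^bsub>R\<^esub> u \<in> ?L +>\<^bsub>R\<^esub> (r \<otimes>\<^bsub>R\<^esub> u)"
    using r assms(4) by (intro self) simp
  ultimately have "r \<otimes>\<^bsub>R\<^esub> u \<in> ?L" by blast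
  then show ?thesis by (auto simp: cgenideal_def)
qed

lemma zero_in_annihilator:
  assumes "left_module R M"
  shows "\<zero>\<^bsub>R\<^esub> \<in> annihilator R M"
proof -
  interpret left_module R M by fact
  have "\<zero>\<^bsub>R\<^esub> \<odot>\<^bsub>M\<^esub> m = \<zero>\<^bsub>M\<^esub>" if m: "m \<in> carrier M" for m
  proof -
    have "\<zero>\<^bsub>R\<^esub> \<odot>\<^bsub>M\<^esub> m \<oplus>\<^bsub>M\<^esub> \<zero>\<^bsub>R\<^esub> \<odot>\<^bsub>M\<^esub> m = \<zero>\<^bsub>R\<^esub> \<odot>\<^bsub>M\<^esub> m"
      using smult_l_distr[of "\<zero>\<^bsub>R\<^esub>" "\<zero>\<^bsub>R\<^esub>" m] m by simp
    then show ?thesis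
      using smult_closed[of "\<zero>\<^bsub>R\<^esub>" m] m by (metis M.add.l_cancel_one R.zero_closed)
  qed
  then show ?thesis by (simp add: annihilator_def)
qed

context lie_algebra_basis
begin

lemma affine_point_inject:
  assumes "affine_point scale bracket x c = affine_point scale bracket x' c'"
  shows "x = x'"
proof -
  have "(free_gen x + cst c) - (free_gen x' + cst c') \<in> I"
    using assms by (simp add: affine_point_def enveloping_coset_eq_iff)
  moreover have "free_gen (x' + (x - x')) - free_gen x' - free_gen (x - x') \<in> I"
    by (rule I_relations)
  ultimately have "(free_gen x + cst c) - (free_gen x' + cst c')
      - (free_gen (x' + (x - x')) - free_gen x' - free_gen (x - x')) \<in> I"
    by (rule I_diff)
  then have "free_gen (x - x') + cst (c - c') \<in> I"
    by (simp add: single_diff algebra_simps)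
  then show ?thesis
    by (auto dest: zero_if_affine_in_enveloping_ideal)
qed

lemma affine_point_add:
  "affine_point scale bracket x c \<oplus>\<^bsub>enveloping_U1 scale bracket\<^esub> affine_point scale bracket x' c'
    = affine_point scale bracket (x + x') (c + c')"
proof -
  have "(free_gen x + cst c) + (free_gen x' + cst c') - (free_gen (x + x') + cst (c + c')) \<in> I"
    using I_uminus[OF I_relations(1)[of x x']] by (simp add: single_add algebra_simps)
  then show ?thesis
    by (simp add: enveloping_U1_def Let_def affine_point_def enveloping_algebra_sel
        enveloping_coset_eq_iff)
qed

lemma affine_point_smult:
  "d \<odot>\<^bsub>enveloping_U1 scale bracket\<^esub> affine_point scale bracket x c
    = affine_point scale bracket (scale d x) (d * c)"
proof -
  have "cst d * (free_gen x + cst c) - (free_gen (scale d x) + cst (d * c)) \<in> I"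
    using I_uminus[OF I_relations(2)[of d x]] by (simp add: mult_single algebra_simps)
  then show ?thesis
    by (simp add: enveloping_U1_def Let_def affine_point_def enveloping_algebra_sel
        enveloping_coset_eq_iff free_scalar_def)
qed

text \<open>
  By \<open>affine_point_inject\<close> the choice is unique on \<open>U\<^sub>1\<close>, so this is the linear projection of \<open>U\<^sub>1\<close> onto the
  Lie algebra.
\<close>

definition lie_part :: "('k, 'g) free_alg set \<Rightarrow> 'g" where
  "lie_part u = (SOME x. \<exists>c. u = affine_point scale bracket x c)"

lemma lie_part_affine_point [simp]: "lie_part (affine_point scale bracket x c) = x"
proof -
  have "\<exists>c'. affine_point scale bracket x c
      = affine_point scale bracket (lie_part (affine_point scale bracket x c)) c'"
    unfolding lie_part_def by (rule someI_ex) blast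
  then show ?thesis by (auto dest: affine_point_inject)
qed

text \<open>
  The vector \<open>g\<close> is an eigenvector of every \<open>ad y\<close> iff all \<open>2 \<times> 2\<close> minors of the pairs \<open>([y, g], g)\<close> vanish;
  for \<open>g = 0\<close> both conditions hold. The minors are polynomial functions because the coordinates of \<open>g\<close> and
  of \<open>[y, g]\<close> are linear in the point \<open>g + c\<close>.
\<close>

theorem zariski_open_not_eigenvector:
  "zariski_open (enveloping_U1 scale bracket)
    {affine_point scale bracket g c | g c. \<exists>y. bracket y g \<notin> range (\<lambda>k. scale k g)}"
    (is "zariski_open ?U ?S")
proof -
  define minor where "minor y i j u =
      coord i (bracket y (lie_part u)) * coord j (lie_part u)
      + (- 1) * (coord j (bracket y (lie_part u)) * coord i (lie_part u))" for y i j u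
  have functional: "polynomial_function ?U (\<lambda>u. coord i (bracket y (lie_part u)))"
    "polynomial_function ?U (\<lambda>u. coord i (lie_part u))" for i y
    by (rule polynomial_function.linear, auto simp: linear_functional_def carrier_U1
        affine_point_add affine_point_smult bracket_add_right bracket_scale_right coord_add coord_scale)+
  have minor_poly: "polynomial_function ?U (minor y i j)" for y i j
    unfolding minor_def by (intro polynomial_function.intros functional)
  have minor_zero: "minor y i j (affine_point scale bracket g c) = 0"
    if "bracket y g = scale k g" for y i j g c k
    using that by (simp add: minor_def coord_scale)
  have eigen: "(\<forall>y i j. minor y i j (affine_point scale bracket g c) = 0)
      \<longleftrightarrow> (\<forall>y. bracket y g \<in> range (\<lambda>k. scale k g))" for g c
  proof
    assume minors: "\<forall>y i j. minor y i j (affine_point scale bracket g c) = 0"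
    show "\<forall>y. bracket y g \<in> range (\<lambda>k. scale k g)"
    proof
      fix y
      show "bracket y g \<in> range (\<lambda>k. scale k g)"
      proof (cases "\<exists>j<n. coord j g \<noteq> 0")
        case True
        then obtain j where j: "coord j g \<noteq> 0" by blast
        define k where "k = coord j (bracket y g) / coord j g"
        have coord: "coord i (bracket y g) = k * coord i g" for i
          using minors[rule_format, of y i j] j by (simp add: k_def minor_def field_simps)
        have "bracket y g = (\<Sum>i<n. scale (coord i (bracket y g)) (b i))"
          by (rule expand)
        also have "\<dots> = scale k (\<Sum>i<n. scale (coord i g) (b i))"
          unfolding coord by (simp add: scale_sum_right)
        also have "\<dots> = scale k g"
          by (simp flip: expand)
        finally show ?thesis by blast
      next
        case False
        have "g = (\<Sum>i<n. scale (coord i g) (b i))" by (rule expand)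
        also have "\<dots> = 0" using False by (intro sum.neutral) simp
        finally have "g = 0" .
        then have "bracket y g = scale 0 g"
          using bracket_scale_right[of y 0 g] by simp
        then show ?thesis by blast
      qed
    qed
  next
    assume "\<forall>y. bracket y g \<in> range (\<lambda>k. scale k g)"
    then have "\<exists>k. bracket y g = scale k g" for y by blast
    then show "\<forall>y i j. minor y i j (affine_point scale bracket g c) = 0"
      by (metis (no_types, lifting) minor_zero)
  qed
  let ?P = "{minor y i j | y i j. True}"
  have "carrier ?U - ?S = zero_locus ?U ?P"
  proof (rule Set.set_eqI)
    fix u
    show "u \<in> carrier ?U - ?S \<longleftrightarrow> u \<in> zero_locus ?U ?P"
    proof (cases "u \<in> carrier ?U")
      case True
      then obtain g c where u: "u = affine_point scale bracket g c" unfolding carrier_U1 by blast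
      have S: "u \<in> ?S \<longleftrightarrow> (\<exists>y. bracket y g \<notin> range (\<lambda>k. scale k g))"
        unfolding u by (auto dest: affine_point_inject)
      have P: "u \<in> zero_locus ?U ?P \<longleftrightarrow> (\<forall>y i j. minor y i j u = 0)"
        using True unfolding zero_locus_def by blast
      show ?thesis unfolding Diff_iff S P using True eigen[of g c, folded u] by blast
    qed (simp add: zero_locus_def)
  qed
  moreover have "?S \<subseteq> carrier ?U" unfolding carrier_U1 by blast
  ultimately show ?thesis
    unfolding zariski_open_def using minor_poly by (intro conjI exI[of _ ?P]) auto
qed

theorem faithful_cyclic_quotient:
  assumes "1 < n" "bracket y (b 0) = b 1" "\<And>k. 0 < k \<Longrightarrow> of_nat k \<noteq> (0::'k)"
  shows "faithful_module (enveloping_algebra scale bracket)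
    (cyclic_quotient (enveloping_algebra scale bracket) (affine_point scale bracket (b 0) c))"
proof -
  let ?U = "enveloping_algebra scale bracket" and ?x = "affine_point scale bracket (b 0) c"
  have U: "ring ?U" by (rule enveloping_algebra_ring)
  have x: "?x \<in> carrier ?U" by (simp add: affine_point_def enveloping_carrier)
  have left: "left_module ?U (cyclic_quotient ?U ?x)"
    using U x by (rule left_module_cyclic_quotient)
  have "r = \<zero>\<^bsub>?U\<^esub>" if r: "r \<in> annihilator ?U (cyclic_quotient ?U ?x)" for r
  proof -
    obtain a where a: "r = I +>\<^bsub>free_ring\<^esub> a"
      using r unfolding annihilator_def enveloping_carrier by blast
    have "\<exists>v. a * u - v * (free_gen (b 0) + cst c) \<in> I" for u
    proof -
      obtain v where "r \<otimes>\<^bsub>?U\<^esub> (I +>\<^bsub>free_ring\<^esub> u) = (I +>\<^bsub>free_ring\<^esub> v) \<otimes>\<^bsub>?U\<^esub> ?x"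
        using cyclic_quotient_annihilator[OF U x r, of "I +>\<^bsub>free_ring\<^esub> u"]
        unfolding enveloping_carrier by blast
      then show ?thesis
        by (auto simp: a affine_point_def enveloping_algebra_sel enveloping_coset_eq_iff)
    qed
    then have "a \<in> I" using assms by (intro cyclic_annihilator_trivial)
    then show ?thesis by (simp add: a enveloping_zero enveloping_coset_eq_iff)
  qed
  then show ?thesis
    using left zero_in_annihilator[OF left] unfolding faithful_module_def by blast
qed

end

section \<open>Adapted bases and the choice of the open set\<close>

text \<open>
  The main argument takes the list \<open>[g, [y, g]]\<close>, so that these are the first two basis vectors; for the
  open set any basis will do, and the list is empty.
\<close>

lemma (in finite_dimensional_vector_space) ex_coordinates:
  assumes "distinct l" "independent (set l)"
  shows "\<exists>n b coord. length l \<le> n \<and> (\<forall>i<length l. b i = l ! i)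
    \<and> (\<forall>i x y. coord i (x + y) = coord i x + coord i y) \<and> (\<forall>i c x. coord i (scale c x) = c * coord i x)
    \<and> (\<forall>i j. j < n \<longrightarrow> coord i (b j) = (if i = j then 1 else 0))
    \<and> (\<forall>x. x = (\<Sum>i<n. scale (coord i x) (b i)))"
proof -
  define B where "B = extend_basis (set l)"
  have B: "independent B" "set l \<subseteq> B" "span B = UNIV"
    using assms(2) by (simp_all add: B_def independent_extend_basis extend_basis_superset)
  then have "finite (B - set l)" using finiteI_independent by blast
  then obtain l' where l': "set l' = B - set l" "distinct l'"
    using finite_distinct_list by blast
  define L where "L = l @ l'"
  have L: "distinct L" "set L = B" using l' assms(1) B(2) by (auto simp: L_def)
  define coord where "coord i x = (if i < length L then representation B x (L ! i) else 0)" for i x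
  have "x = (\<Sum>i<length L. scale (coord i x) (L ! i))" for x
  proof -
    have "(\<Sum>i<length L. scale (coord i x) (L ! i)) = (\<Sum>v\<in>B. scale (representation B x v) v)"
      using sum.reindex_bij_betw[OF bij_betw_nth[OF L(1) refl L(2)[symmetric]],
          of "\<lambda>v. scale (representation B x v) v"]
      by (simp add: coord_def)
    also have "\<dots> = x"
      using B L by (intro sum_representation_eq) auto
    finally show ?thesis by simp
  qed
  moreover have "coord i (L ! j) = (if i = j then 1 else 0)" if "j < length L" for i j
    using that B(1) L by (auto simp: coord_def representation_basis nth_eq_iff_index_eq)
  ultimately show ?thesis
    using B by (intro exI[of _ "length L"] exI[of _ "(!) L"] exI[of _ coord])
      (auto simp: L_def nth_append coord_def representation_add representation_scale)
qed

lemma ex_lie_algebra_basis: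
  assumes "lie_algebra scale bracket" "finite_dimensional_vector_space scale Basis"
    and "distinct l" "\<not> module.dependent scale (set l)"
  shows "\<exists>n b coord. lie_algebra_basis scale bracket n b coord \<and> length l \<le> n \<and> (\<forall>i<length l. b i = l ! i)"
proof -
  interpret lie_algebra scale bracket by fact
  obtain n b coord where "length l \<le> n" "\<forall>i<length l. b i = l ! i"
    "\<forall>i x y. coord i (x + y) = coord i x + coord i y" "\<forall>i c x. coord i (scale c x) = c * coord i x"
    "\<forall>i j. j < n \<longrightarrow> coord i (b j) = (if i = j then 1 else 0)"
    "\<forall>x. x = (\<Sum>i<n. scale (coord i x) (b i))"
    using finite_dimensional_vector_space.ex_coordinates[OF assms(2-4)] by blast
  moreover have "lie_algebra_basis scale bracket n b coord"
    by unfold_locales (use calculation in blast)+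
  ultimately show ?thesis by blast
qed

text \<open>
  Suppose that \<open>[x, y] \<noteq> 0\<close> and all vectors are eigenvectors. Then \<open>[x, y] = k y\<close> with \<open>k \<noteq> 0\<close>, and
  \<open>[y, x] = m x\<close>, so \<open>y\<close> is a multiple of \<open>x\<close> and \<open>[x, y] = 0\<close>.
\<close>

lemma (in lie_algebra) ex_not_eigenvector:
  assumes "\<not> abelian_bracket bracket"
  shows "\<exists>g y. bracket y g \<notin> range (\<lambda>k. scale k g)"
proof (rule ccontr)
  assume "\<nexists>g y. bracket y g \<notin> range (\<lambda>k. scale k g)"
  then have eigen: "\<exists>k. bracket y g = scale k g" for y g by blast
  obtain x y where xy: "bracket x y \<noteq> 0" using assms by (auto simp: abelian_bracket_def)
  obtain k m where km: "bracket x y = scale k y" "bracket y x = scale m x" using eigen by metis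
  have "y = scale (inverse k) (scale k y)" using km xy by auto
  also have "\<dots> = scale (- (inverse k * m)) x"
    using bracket_antisym[of x y] km by simp
  finally have "bracket x y = scale (- (inverse k * m)) (bracket x x)"
    using bracket_scale_right by metis
  then show False using xy by (simp add: bracket_self)
qed

theorem theorem1p1:
  fixes scale :: "'k::{alg_closed_field, field_char_0} \<Rightarrow> 'g::ab_group_add \<Rightarrow> 'g"
    and bracket :: "'g \<Rightarrow> 'g \<Rightarrow> 'g"
  assumes "lie_algebra scale bracket"
    and "\<exists>Basis. finite_dimensional_vector_space scale Basis"
    and "\<not> abelian_bracket bracket"
  shows "\<exists>S. openin (zariski_topology (enveloping_U1 scale bracket)) S \<and> S \<noteq> {} \<and>
           (\<forall>x\<in>S. faithful_module (enveloping_algebra scale bracket)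
                    (cyclic_quotient (enveloping_algebra scale bracket) x))"
proof -
  interpret lie_algebra scale bracket by fact
  obtain Basis where Basis: "finite_dimensional_vector_space scale Basis" using assms(2) by blast
  let ?S = "{affine_point scale bracket g c | g c. \<exists>y. bracket y g \<notin> range (\<lambda>k. scale k g)}"
  obtain n b coord where "lie_algebra_basis scale bracket n b coord"
    using ex_lie_algebra_basis[OF assms(1) Basis, of "[]"] independent_empty by auto
  then have "zariski_open (enveloping_U1 scale bracket) ?S"
    by (rule lie_algebra_basis.zariski_open_not_eigenvector)
  moreover have "?S \<noteq> {}" using ex_not_eigenvector[OF assms(3)] by blast
  moreover have "faithful_module (enveloping_algebra scale bracket)
      (cyclic_quotient (enveloping_algebra scale bracket) x)" if "x \<in> ?S" for x
  proof -
    obtain g c y where x: "x = affine_point scale bracket g c"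
      and y: "bracket y g \<notin> range (\<lambda>k. scale k g)"
      using \<open>x \<in> ?S\<close> by blast
    have "bracket y g \<notin> span {g}" using y by (simp add: span_singleton)
    moreover have "g \<noteq> 0"
    proof
      assume "g = 0"
      moreover have "bracket y 0 = 0"
        using bracket_scale_right[of y 0 0] by simp
      ultimately show False using y by auto
    qed
    ultimately have "distinct [g, bracket y g]" "independent (set [g, bracket y g])"
      by (auto simp: independent_insert insert_commute[of g] span_base)
    then obtain n b coord where basis: "lie_algebra_basis scale bracket n b coord"
      and b: "length [g, bracket y g] \<le> n" "\<forall>i<length [g, bracket y g]. b i = [g, bracket y g] ! i"
      using ex_lie_algebra_basis[OF assms(1) Basis] by blast
    have "b 0 = g" "b 1 = bracket y g" "1 < n" using b by auto
    then show ?thesis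
      using lie_algebra_basis.faithful_cyclic_quotient[OF basis, of y c] by (simp add: x)
  qed
  ultimately show ?thesis by (intro exI[of _ ?S]) simp
qed

end
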